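(* Let $j\le k$ be real numbers. The space of pointwise multipliers from $\mathcal B_{\omega^k}(\mathbb C_+)$ to $\mathcal B_{\omega^j}(\mathbb C_+)$, i.e. of holomorphic functions $b$ on $\mathbb C_+$ such that $bf\in\mathcal B_{\omega^j}(\mathbb C_+)$ for every $f\in\mathcal B_{\omega^k}(\mathbb C_+)$, consists of: (1) when $k>1$, the functions in $\mathcal B_{\omega^j}(\mathbb C_+)$; (2) when $k<1$, the functions in $\mathcal B_{\omega^{j+1-k}}(\mathbb C_+)\cap H^\infty_{\omega^{j-k}}(\mathbb C_+)$; (3) when $k=1$, the functions $b\in H^\infty_{\omega^{j-1}}(\mathbb C_+)$ satisfying the condition $$\sup_{z\in\mathbb C_+}\left(\Im m(z)\right)\omega^j(z)\left(1+\ln(\omega(z))\right)|b'(z)|<\infty.$$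
   Context: $\mathbb C_+=\{z\in\mathbb C:\Im m(z)>0\}$. With $\ln_+(t)=\max(\ln t,0)$, put $\omega(z)=1+\ln_+\left(\frac1{\Im m(z)}\right)+\ln_+(|z|)$. For $s\in\mathbb R$, $\mathcal B_{\omega^s}(\mathbb C_+)$ is the space of holomorphic functions $f$ on $\mathbb C_+$ (functions, not classes modulo constants) with $\|f\|_{\mathcal B_{\omega^s}}=|f(i)|+\sup_{z}\Im m(z)\,\omega^s(z)|f'(z)|<\infty$. $H^\infty_{\omega^s}(\mathbb C_+)$ is the space of holomorphic functions $f$ on $\mathbb C_+$ with $\sup_{z}|f(z)|\,\omega^s(z)<\infty$. *)

theory Defs
  imports "HOL-Complex_Analysis.Complex_Analysis" "HOL-Library.Extended_Nonnegative_Real"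
begin

definition upper_half_plane :: "complex set"
  where "upper_half_plane = {z. Im z > 0}"

definition ln_plus :: "real \<Rightarrow> real"
  where "ln_plus t = max (ln t) 0"

definition omega :: "complex \<Rightarrow> real"
  where "omega z = 1 + ln_plus (1 / Im z) + ln_plus (cmod z)"

text \<open>
  A function on the upper half-plane is represented by a total function on the complex numbers
  whose values off the half-plane are irrelevant: every predicate below depends only on the
  restriction to the (open) half-plane. Norms take values in the extended nonnegative reals,
  so that an unbounded supremum is infinite.
\<close>

definition bloch_norm :: "real \<Rightarrow> (complex \<Rightarrow> complex) \<Rightarrow> ennreal"
  where "bloch_norm s f = ennreal (cmod (f \<i>)) +
    (SUP z\<in>upper_half_plane. ennreal (Im z * omega z powr s * cmod (deriv f z)))"

definition bloch_space :: "real \<Rightarrow> (complex \<Rightarrow> complex) set"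
  where "bloch_space s = {f. f holomorphic_on upper_half_plane \<and> bloch_norm s f < \<infinity>}"

definition H_infinity :: "real \<Rightarrow> (complex \<Rightarrow> complex) set"
  where "H_infinity s = {f. f holomorphic_on upper_half_plane \<and>
    (SUP z\<in>upper_half_plane. ennreal (cmod (f z) * omega z powr s)) < \<infinity>}"

definition pointwise_multipliers ::
    "(complex \<Rightarrow> complex) set \<Rightarrow> (complex \<Rightarrow> complex) set \<Rightarrow> (complex \<Rightarrow> complex) set"
  where "pointwise_multipliers X Y =
    {b. b holomorphic_on upper_half_plane \<and> (\<forall>f\<in>X. (\<lambda>z. b z * f z) \<in> Y)}"

end

theory Submission
  imports Defs
begin

text \<open>
  The Cayley transform carries everything to the unit disc: there \<open>\<omega>\<close> becomes comparable to the radial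
  weight \<open>L(\<zeta>) = 1 - ln (1 - |\<zeta>|)\<close>, and \<open>2 Im z |f'(z)|\<close> becomes \<open>(1 - |\<zeta>|\<^sup>2) |g'(\<zeta>)|\<close>. Since \<open>L' = 1 / (1 - r)\<close>,
  integrating along radii shows that a function of the weighted Bloch space of order \<open>k\<close> grows at
  most like \<open>L\<^bsup>1-k\<^esup>\<close>, \<open>1 + ln L\<close> or \<open>1\<close>, according to \<open>k < 1\<close>, \<open>k = 1\<close> or \<open>k > 1\<close>; the product rule then gives
  sufficiency. For necessity with \<open>k > 1\<close> the multiplier is tested on the constant \<open>1\<close>. For \<open>k \<le> 1\<close>, the
  uniform boundedness principle makes the multiplier a bounded operator, which is tested at each
  point \<open>a\<close> on two functions built from \<open>h(\<zeta>) = 2 - Ln (1 - cnj a \<zeta>)\<close>: one, \<open>h\<^bsup>1-k\<^esup>\<close> or \<open>1 + Ln h\<close>, has the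
  maximal growth at \<open>a\<close>, the other, \<open>h\<^bsup>-k\<^esup> (\<zeta> - a) / (1 - cnj a \<zeta>)\<close>, vanishes at \<open>a\<close> with maximal derivative.
\<close>

subsection \<open>Growth of weighted Bloch functions on the disc\<close>

definition disc_weight :: "real \<Rightarrow> real"
  where "disc_weight r = 1 - ln (1 - r)"

lemma disc_weight_ge_1: "0 \<le> r \<Longrightarrow> r < 1 \<Longrightarrow> 1 \<le> disc_weight r"
  by (simp add: disc_weight_def)

lemma disc_weight_mono: "r \<le> s \<Longrightarrow> s < 1 \<Longrightarrow> disc_weight r \<le> disc_weight s"
  by (simp add: disc_weight_def)

text \<open>The primitive of \<open>x powr (- s)\<close> that vanishes at 1, the value of
  \<open>disc_weight\<close> at the origin. Composed with \<open>disc_weight\<close>, it majorises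
  the radial growth of functions of order \<open>s\<close>.\<close>

definition growth :: "real \<Rightarrow> real \<Rightarrow> real"
  where "growth s x = (if s = 1 then ln x else (x powr (1 - s) - 1) / (1 - s))"

lemma growth_1 [simp]: "growth s 1 = 0"
  by (simp add: growth_def)

lemma growth_deriv:
  assumes "0 < x"
  shows "(growth s has_real_derivative x powr (- s)) (at x)"
proof (cases "s = 1")
  case True
  have "growth s = ln" by (auto simp: growth_def True)
  then show ?thesis
    using assms True by (auto intro!: derivative_eq_intros simp: powr_minus field_simps)
next
  case False
  have "growth s = (\<lambda>x. (x powr (1 - s) - 1) / (1 - s))" by (auto simp: growth_def False)
  moreover have "((\<lambda>x. (x powr (1 - s) - 1) / (1 - s)) has_real_derivative
      ((1 - s) * x powr (1 - s - 1) - 0) / (1 - s)) (at x)"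
    using assms by (intro DERIV_cdivide DERIV_diff DERIV_const has_real_derivative_powr)
  ultimately show ?thesis using False by simp
qed

lemma growth_mono:
  assumes "0 < x" "x \<le> y"
  shows "growth s x \<le> growth s y"
  by (rule DERIV_nonneg_imp_nondecreasing[OF assms(2)])
    (use assms in \<open>auto intro!: exI[where P="\<lambda>y. _ y \<and> _ y"] growth_deriv\<close>)

lemma growth_less_1:
  assumes "s < 1"
  shows "growth s x \<le> x powr (1 - s) / (1 - s)"
  using assms by (simp add: growth_def divide_right_mono)

lemma growth_greater_1:
  assumes "1 < s"
  shows "growth s x \<le> 1 / (s - 1)"
proof -
  have "growth s x = (1 - x powr (1 - s)) / (s - 1)"
    using assms by (simp add: growth_def field_simps)
  also have "\<dots> \<le> 1 / (s - 1)" using assms by (intro divide_right_mono) auto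
  finally show ?thesis .
qed

text \<open>The growth of order \<open>j\<close> is a power x^(1-j), a logarithm or a constant.
  Multiplied by x^(j-k) it becomes x^(1-k), a logarithm times x^(1-k), or a nonincreasing power;
  \<open>1 < k\<close> makes the first two bounded. This is why the condition on the values of a
  multiplier is automatic for \<open>1 < k\<close>.\<close>

lemma growth_times_powr_bounded:
  assumes "j \<le> k" "1 < k"
  obtains C where "\<And>x. 1 \<le> x \<Longrightarrow> growth j x * x powr (j - k) \<le> C"
proof -
  consider "j < 1" | "j = 1" | "1 < j" by linarith
  then show ?thesis
  proof cases
    case 1
    have "growth j x * x powr (j - k) \<le> 1 / (1 - j)" if "1 \<le> x" for x
    proof -
      have "growth j x * x powr (j - k) \<le> x powr (1 - j) / (1 - j) * x powr (j - k)"
        using growth_less_1[OF 1] by (intro mult_right_mono) auto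
      also have "\<dots> = x powr (1 - k) / (1 - j)"
        using that by (simp add: powr_add[symmetric])
      also have "\<dots> \<le> x powr 0 / (1 - j)"
        using that 1 assms by (intro divide_right_mono powr_mono) auto
      finally show ?thesis using that by simp
    qed
    then show ?thesis using that by blast
  next
    case 2
    have "growth j x * x powr (j - k) \<le> 1 / (k - 1)" if "1 \<le> x" for x
    proof -
      have "ln x \<le> x powr (k - 1) / (k - 1)"
        using that assms by (intro ln_powr_bound) auto
      then have "growth j x * x powr (j - k) \<le> x powr (k - 1) / (k - 1) * x powr (j - k)"
        by (intro mult_right_mono) (auto simp: growth_def 2)
      also have "\<dots> = 1 / (k - 1)"
        using that by (simp add: powr_add[symmetric] 2)
      finally show ?thesis .
    qed
    then show ?thesis using that by blast
  next
    case 3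
    have "growth j x * x powr (j - k) \<le> 1 / (j - 1)" if "1 \<le> x" for x
    proof -
      have "growth j x * x powr (j - k) \<le> 1 / (j - 1) * x powr (j - k)"
        using growth_greater_1[OF 3] by (intro mult_right_mono) auto
      also have "\<dots> \<le> 1 / (j - 1) * x powr 0"
        using that 3 assms by (intro mult_left_mono powr_mono) auto
      finally show ?thesis using that by simp
    qed
    then show ?thesis using that by blast
  qed
qed

text \<open>The constant is explicit so that bounds uniform over a family can be stated; the value
  \<open>g 0\<close> is tracked separately. The factor \<open>1 - cmod \<zeta>\<close> replaces the
  conformally natural 1 - |\<zeta>|^2, from which it differs by a factor of at most 2.\<close>

definition bloch_disc_bound :: "real \<Rightarrow> real \<Rightarrow> (complex \<Rightarrow> complex) \<Rightarrow> bool"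
  where "bloch_disc_bound s C g \<longleftrightarrow> g holomorphic_on ball 0 1 \<and>
    (\<forall>\<zeta>\<in>ball 0 1. (1 - cmod \<zeta>) * disc_weight (cmod \<zeta>) powr s * cmod (deriv g \<zeta>) \<le> C)"

lemma bloch_disc_boundD:
  assumes "bloch_disc_bound s C g" "cmod \<zeta> < 1"
  shows "(1 - cmod \<zeta>) * disc_weight (cmod \<zeta>) powr s * cmod (deriv g \<zeta>) \<le> C"
  using assms by (auto simp: bloch_disc_bound_def)

lemma bloch_disc_bound_deriv:
  assumes "bloch_disc_bound s C g" "cmod \<zeta> < 1"
  shows "(g has_field_derivative deriv g \<zeta>) (at \<zeta>)"
  using assms holomorphic_derivI[of g "ball 0 1" \<zeta>] by (auto simp: bloch_disc_bound_def)

lemma bloch_disc_bound_nonneg: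
  assumes "bloch_disc_bound s C g"
  shows "0 \<le> C"
proof -
  have "0 \<le> (1 - cmod 0) * disc_weight (cmod 0) powr s * cmod (deriv g 0)" by simp
  also have "\<dots> \<le> C" using assms by (rule bloch_disc_boundD) simp
  finally show ?thesis .
qed

text \<open>With r = |\<zeta>| and L the weight, the derivative of x -> g(x \<zeta>) is at most C r
  / ((1 - x r) L(x r)^s), and this is exactly the derivative of C times \<open>growth s\<close> at
  L(x r). The mean value inequality on [0,1] compares the two.\<close>

lemma bloch_disc_growth:
  assumes g: "bloch_disc_bound s C g" and \<zeta>: "cmod \<zeta> < 1"
  shows "cmod (g \<zeta>) \<le> cmod (g 0) + C * growth s (disc_weight (cmod \<zeta>))"
proof -
  let ?r = "cmod \<zeta>"
  have less: "x * ?r < 1" if "0 \<le> x" "x \<le> 1" for x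
    using mult_right_mono[of x 1 ?r] that \<zeta> by simp
  have f': "((\<lambda>x. g (of_real x * \<zeta>)) has_vector_derivative \<zeta> * deriv g (of_real x * \<zeta>)) (at x)"
    if "0 \<le> x" "x \<le> 1" for x
  proof -
    have "((\<lambda>x. of_real x * \<zeta>) has_vector_derivative \<zeta>) (at x)"
      by (auto intro!: derivative_eq_intros)
    moreover have "(g has_field_derivative deriv g (of_real x * \<zeta>)) (at (of_real x * \<zeta>))"
      using that less by (intro bloch_disc_bound_deriv[OF g]) (auto simp: norm_mult)
    ultimately show ?thesis
      using field_vector_diff_chain_at[of "\<lambda>x. of_real x * \<zeta>" \<zeta> x g] by (simp add: o_def)
  qed
  have w: "1 \<le> disc_weight (x * ?r)" if "0 \<le> x" "x \<le> 1" for x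
    using that less by (intro disc_weight_ge_1) auto
  have phi': "((\<lambda>x. C * growth s (disc_weight (x * ?r))) has_real_derivative
      C * (disc_weight (x * ?r) powr (- s) * (?r / (1 - x * ?r)))) (at x)"
    if "0 \<le> x" "x \<le> 1" for x
  proof -
    have "((\<lambda>x. disc_weight (x * ?r)) has_real_derivative ?r / (1 - x * ?r)) (at x)"
      using less[OF that] unfolding disc_weight_def
      by (auto intro!: derivative_eq_intros simp: field_simps)
    from DERIV_chain2[OF growth_deriv this, of s] w[OF that] show ?thesis
      by (intro DERIV_cmult) simp
  qed
  have "norm (g (of_real 1 * \<zeta>) - g (of_real 0 * \<zeta>))
      \<le> C * growth s (disc_weight (1 * ?r)) - C * growth s (disc_weight (0 * ?r))"
  proof (rule differentiable_bound_general[of 0 1 "\<lambda>x. g (of_real x * \<zeta>)"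
        "\<lambda>x. C * growth s (disc_weight (x * ?r))"])
    show "continuous_on {0..1} (\<lambda>x. g (of_real x * \<zeta>))"
      using f' by (intro continuous_at_imp_continuous_on)
        (meson atLeastAtMost_iff has_vector_derivative_continuous)
    show "continuous_on {0..1} (\<lambda>x. C * growth s (disc_weight (x * ?r)))"
      using phi' by (intro continuous_at_imp_continuous_on) (meson atLeastAtMost_iff DERIV_isCont)
  next
    fix x :: real assume x: "0 < x" "x < 1"
    show "((\<lambda>x. g (of_real x * \<zeta>)) has_vector_derivative \<zeta> * deriv g (of_real x * \<zeta>)) (at x)"
      using x by (intro f') auto
    show "((\<lambda>x. C * growth s (disc_weight (x * ?r))) has_vector_derivative
      C * (disc_weight (x * ?r) powr (- s) * (?r / (1 - x * ?r)))) (at x)"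
      using phi'[of x] x by (simp add: has_real_derivative_iff_has_vector_derivative)
    let ?w = "disc_weight (x * ?r)" and ?d = "cmod (deriv g (of_real x * \<zeta>))"
    have "(1 - x * ?r) * ?w powr s * ?d \<le> C"
      using bloch_disc_boundD[OF g, of "of_real x * \<zeta>"] less[of x] x by (simp add: norm_mult)
    moreover have "0 < (1 - x * ?r) * ?w powr s" using less[of x] w[of x] x by simp
    ultimately have "?d \<le> C / ((1 - x * ?r) * ?w powr s)"
      by (simp add: pos_le_divide_eq mult.commute)
    then have "?r * ?d \<le> ?r * (C / ((1 - x * ?r) * ?w powr s))"
      by (intro mult_left_mono) auto
    then show "norm (\<zeta> * deriv g (of_real x * \<zeta>))
        \<le> C * (?w powr (- s) * (?r / (1 - x * ?r)))"
      by (simp add: norm_mult powr_minus divide_simps mult_ac)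
  qed auto
  \<comment> \<open>At the lower end of the radius the weight is 1, where \<open>growth\<close>
    vanishes.\<close>
  then have "norm (g \<zeta> - g 0) \<le> C * growth s (disc_weight ?r)"
    by (simp add: disc_weight_def)
  then show ?thesis using norm_triangle_sub[of "g \<zeta>" "g 0"] by linarith
qed

subsection \<open>Uniform boundedness\<close>

text \<open>
  The elementary proof of the uniform boundedness principle (Sokal): the \<open>i\<close>-th summand of a series
  in the unit ball has weight \<open>3\<^bsup>-i\<^esup>\<close>, and its sign is chosen so that it does not cancel against the
  earlier ones under the \<open>i\<close>-th functional, whose norm is at least \<open>4\<^bsup>i\<^esup>\<close>.
\<close>

lemma sign_choice:
  fixes b :: "nat \<Rightarrow> nat \<Rightarrow> 'a::real_normed_vector"
  obtains \<epsilon> :: "nat \<Rightarrow> real"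
  where "\<And>n. \<bar>\<epsilon> n\<bar> = 1" "\<And>n. norm (b n n) \<le> norm (\<Sum>i<Suc n. \<epsilon> i *\<^sub>R b n i)"
proof -
  define P where "P f n r \<longleftrightarrow> \<bar>r\<bar> = 1 \<and> norm (b n n) \<le> norm ((\<Sum>i<n. f i *\<^sub>R b n i) + r *\<^sub>R b n n)"
    for f :: "nat \<Rightarrow> real" and n and r :: real
  have "\<exists>f. \<forall>n. P f n (f n)"
  proof (rule dependent_wf_choice)
    show "wf less_than" by simp
    show "P f x r = P g x r" if "\<And>z. (z, x) \<in> less_than \<Longrightarrow> f z = g z" for f g x r
    proof -
      have "(\<Sum>i<x. f i *\<^sub>R b x i) = (\<Sum>i<x. g i *\<^sub>R b x i)"
        using that by (intro sum.cong) auto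
      then show ?thesis by (simp add: P_def)
    qed
    show "\<exists>r. P f x r" for x f
    proof -
      let ?u = "\<Sum>i<x. f i *\<^sub>R b x i" and ?v = "b x x"
      have "2 * norm ?v = norm ((?u + ?v) - (?u - ?v))"
        by (simp add: scaleR_2[symmetric])
      also have "\<dots> \<le> norm (?u + ?v) + norm (?u - ?v)" by (rule norm_triangle_ineq4)
      finally have "norm ?v \<le> norm (?u + ?v) \<or> norm ?v \<le> norm (?u - ?v)" by linarith
      then have "P f x 1 \<or> P f x (-1)" by (simp add: P_def)
      then show ?thesis by blast
    qed
  qed
  then show ?thesis using that by (auto simp: P_def add.commute)
qed

text \<open>The growth estimate bounds the normalised functions \<open>g i\<close> locally
  uniformly, so an absolutely summable combination converges locally uniformly and may be
  differentiated term by term. This takes the place of completeness of the Bloch space.\<close>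

lemma bloch_disc_series:
  fixes c :: "nat \<Rightarrow> real"
  assumes g: "\<And>i. bloch_disc_bound s 1 (g i)" "\<And>i. cmod (g i 0) \<le> 1"
    and c: "summable (\<lambda>i. \<bar>c i\<bar>)"
  obtains f where "bloch_disc_bound s (\<Sum>i. \<bar>c i\<bar>) f"
    and "\<And>\<zeta>. cmod \<zeta> < 1 \<Longrightarrow> (\<lambda>i. of_real (c i) * g i \<zeta>) sums f \<zeta>"
    and "\<And>\<zeta>. cmod \<zeta> < 1 \<Longrightarrow> (\<lambda>i. of_real (c i) * deriv (g i) \<zeta>) sums deriv f \<zeta>"
proof -
  let ?f = "\<lambda>i \<zeta>. of_real (c i) * g i \<zeta>" and ?f' = "\<lambda>i \<zeta>. of_real (c i) * deriv (g i) \<zeta>"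
  have "\<exists>f f'. \<forall>\<zeta>\<in>ball 0 1. (\<lambda>i. ?f i \<zeta>) sums f \<zeta> \<and> (\<lambda>i. ?f' i \<zeta>) sums f' \<zeta> \<and>
      (f has_field_derivative f' \<zeta>) (at \<zeta>)"
  proof (rule series_and_derivative_comparison_local)
    show "(?f i has_field_derivative ?f' i \<zeta>) (at \<zeta>)" if "\<zeta> \<in> ball 0 1" for i \<zeta>
      using that by (intro DERIV_cmult bloch_disc_bound_deriv[OF g(1)]) auto
    fix \<zeta> :: complex assume "\<zeta> \<in> ball 0 1"
    then have \<zeta>: "cmod \<zeta> < 1" by simp
    \<comment> \<open>Halfway between |\<zeta>| and 1: the ball of radius
      \<open>\<rho> - cmod \<zeta>\<close> about \<open>\<zeta>\<close> lies in the disc of radius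
      \<open>\<rho>\<close>, where one growth bound serves all terms.\<close>
    define \<rho> where "\<rho> = (1 + cmod \<zeta>) / 2"
    have \<rho>: "cmod \<zeta> < \<rho>" "\<rho> < 1" using \<zeta> by (auto simp: \<rho>_def)
    let ?K = "1 + growth s (disc_weight \<rho>)"
    have "cmod (?f n y) \<le> \<bar>c n\<bar> * ?K" if "y \<in> ball \<zeta> (\<rho> - cmod \<zeta>)" for n y
    proof -
      have y: "cmod y < \<rho>"
        using that norm_triangle_sub[of y \<zeta>] by (simp add: dist_norm norm_minus_commute)
      have "cmod (g n y) \<le> cmod (g n 0) + 1 * growth s (disc_weight (cmod y))"
        using y \<rho> by (intro bloch_disc_growth[OF g(1)]) auto
      also have "growth s (disc_weight (cmod y)) \<le> growth s (disc_weight \<rho>)"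
        using y \<rho> disc_weight_ge_1[of "cmod y"]
        by (intro growth_mono disc_weight_mono) auto
      finally show ?thesis
        using g(2)[of n] by (auto simp: norm_mult intro!: mult_left_mono)
    qed
    then show "\<exists>d h. 0 < d \<and> summable h \<and>
        (\<forall>\<^sub>F n in sequentially. \<forall>y\<in>ball \<zeta> d \<inter> ball 0 1. cmod (?f n y) \<le> h n)"
      using \<rho> summable_mult2[OF c, of ?K]
      by (intro exI[of _ "\<rho> - cmod \<zeta>"] exI[of _ "\<lambda>n. \<bar>c n\<bar> * ?K"]) auto
  qed auto
  then obtain f f' where f: "\<And>\<zeta>. cmod \<zeta> < 1 \<Longrightarrow> (\<lambda>i. ?f i \<zeta>) sums f \<zeta>"
    and f': "\<And>\<zeta>. cmod \<zeta> < 1 \<Longrightarrow> (\<lambda>i. ?f' i \<zeta>) sums f' \<zeta>"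
    and der: "\<And>\<zeta>. cmod \<zeta> < 1 \<Longrightarrow> (f has_field_derivative f' \<zeta>) (at \<zeta>)"
    unfolding mem_ball_0[symmetric] by blast
  have df: "deriv f \<zeta> = f' \<zeta>" if "cmod \<zeta> < 1" for \<zeta>
    using der[OF that] by (rule DERIV_imp_deriv)
  have "(1 - cmod \<zeta>) * disc_weight (cmod \<zeta>) powr s * cmod (deriv f \<zeta>) \<le> (\<Sum>i. \<bar>c i\<bar>)"
    if \<zeta>: "cmod \<zeta> < 1" for \<zeta>
  proof -
    \<comment> \<open>Multiplying by the weight before summing bounds the i-th term by
      \<open>\<bar>c i\<bar>\<close>.\<close>
    define w where "w = (1 - cmod \<zeta>) * disc_weight (cmod \<zeta>) powr s"
    have w: "0 \<le> w" using \<zeta> by (simp add: w_def)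
    have *: "(\<lambda>i. of_real w * ?f' i \<zeta>) sums (of_real w * f' \<zeta>)"
      using f'[OF \<zeta>] by (rule sums_mult)
    have "norm (of_real w * ?f' i \<zeta>) \<le> \<bar>c i\<bar>" for i
    proof -
      have "norm (of_real w * ?f' i \<zeta>) = \<bar>c i\<bar> * (w * cmod (deriv (g i) \<zeta>))"
        using w by (simp add: norm_mult)
      also have "\<dots> \<le> \<bar>c i\<bar> * 1"
        using bloch_disc_boundD[OF g(1) \<zeta>] unfolding w_def by (intro mult_left_mono) auto
      finally show ?thesis by simp
    qed
    then have "norm (\<Sum>i. of_real w * ?f' i \<zeta>) \<le> (\<Sum>i. \<bar>c i\<bar>)"
      using c by (intro norm_suminf_le) auto
    then have "norm (of_real w * f' \<zeta>) \<le> (\<Sum>i. \<bar>c i\<bar>)"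
      by (simp only: sums_unique[OF *, symmetric])
    then show ?thesis
      using w df[OF \<zeta>] by (simp add: norm_mult flip: w_def)
  qed
  moreover have "f holomorphic_on ball 0 1"
    using der by (metis holomorphic_on_open mem_ball_0 open_ball)
  ultimately have "bloch_disc_bound s (\<Sum>i. \<bar>c i\<bar>) f" by (simp add: bloch_disc_bound_def)
  then show ?thesis using that f f' df by auto
qed

text \<open>Splits a series into a head, which the choice of signs keeps large, and a tail dominated
  by a convergent series.\<close>

lemma norm_sums_ge_diff:
  fixes c :: "nat \<Rightarrow> 'a::banach"
  assumes "c sums s" and tail: "\<And>i. norm (c (i + n)) \<le> h i" and "h sums H"
  shows "norm (\<Sum>i<n. c i) - H \<le> norm s"
proof -
  have "(\<lambda>i. c (i + n)) sums (s - (\<Sum>i<n. c i))"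
    using assms(1) by (rule sums_split_initial_segment)
  then have "norm (s - (\<Sum>i<n. c i)) \<le> H"
    using norm_suminf_le[of "\<lambda>i. c (i + n)" h] tail assms(3) by (simp add: sums_iff)
  then show ?thesis using norm_triangle_ineq2[of "\<Sum>i<n. c i" s] by (simp add: norm_minus_commute)
qed

text \<open>The functionals are the weighted derivatives of \<open>b * g\<close> at the points of
  the disc. Were they not uniformly bounded on the unit ball \<open>G\<close>, the signed series
  would give a function of order \<open>k\<close> whose product with \<open>b\<close> has unbounded
  weighted derivative.\<close>

lemma bloch_disc_multiplier_uniform:
  assumes b: "b holomorphic_on ball 0 1"
    and mult: "\<forall>g C. bloch_disc_bound k C g \<longrightarrow> (\<exists>C'. bloch_disc_bound j C' (\<lambda>\<zeta>. b \<zeta> * g \<zeta>))"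
  obtains M where "\<And>g \<zeta>. bloch_disc_bound k 1 g \<Longrightarrow> cmod (g 0) \<le> 1 \<Longrightarrow> cmod \<zeta> < 1 \<Longrightarrow>
    (1 - cmod \<zeta>) * disc_weight (cmod \<zeta>) powr j * cmod (deriv b \<zeta> * g \<zeta> + b \<zeta> * deriv g \<zeta>) \<le> M"
proof (rule ccontr)
  define G where "G = {g. bloch_disc_bound k 1 g \<and> cmod (g 0) \<le> 1}"
  define w where "w \<zeta> = (1 - cmod \<zeta>) * disc_weight (cmod \<zeta>) powr j" for \<zeta> :: complex
  \<comment> \<open>Linear in \<open>g\<close> and complex-valued, so that it can be applied to the
    series and the sign choice to its values; only its norm is the weighted derivative of the
    product.\<close>
  define l where "l \<zeta> g = of_real (w \<zeta>) * (deriv b \<zeta> * g \<zeta> + b \<zeta> * deriv g \<zeta>)"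
    for \<zeta> :: complex and g :: "complex \<Rightarrow> complex"
  have w: "0 \<le> w \<zeta>" if "cmod \<zeta> < 1" for \<zeta>
    using that by (simp add: w_def)
  have norm_l: "norm (l \<zeta> g) = w \<zeta> * cmod (deriv b \<zeta> * g \<zeta> + b \<zeta> * deriv g \<zeta>)"
    if "cmod \<zeta> < 1" for \<zeta> g
    using w[OF that] by (simp add: l_def norm_mult)
  assume "\<not> thesis"
  then have unbounded: "\<exists>g\<in>G. \<exists>\<zeta>. cmod \<zeta> < 1 \<and> M < norm (l \<zeta> g)" for M
    using that[of M] norm_l by (force simp: G_def w_def not_le)
  \<comment> \<open>Each single functional is bounded on \<open>G\<close>: the growth estimate
    controls \<open>g \<zeta>\<close> and the Bloch bound controls
    \<open>deriv g \<zeta>\<close>.\<close>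
  have bdd: "bdd_above ((\<lambda>g. norm (l \<zeta> g)) ` G)" if \<zeta>: "cmod \<zeta> < 1" for \<zeta>
  proof -
    let ?D = "1 / ((1 - cmod \<zeta>) * disc_weight (cmod \<zeta>) powr k)"
    let ?K = "w \<zeta> * (cmod (deriv b \<zeta>) * (1 + growth k (disc_weight (cmod \<zeta>))) + cmod (b \<zeta>) * ?D)"
    have "norm (l \<zeta> g) \<le> ?K" if "g \<in> G" for g
    proof -
      from that have g: "bloch_disc_bound k 1 g" "cmod (g 0) \<le> 1" by (auto simp: G_def)
      have "cmod (g \<zeta>) \<le> 1 + growth k (disc_weight (cmod \<zeta>))"
        using bloch_disc_growth[OF g(1) \<zeta>] g(2) by simp
      moreover have "cmod (deriv g \<zeta>) \<le> ?D"
        using bloch_disc_boundD[OF g(1) \<zeta>] disc_weight_ge_1[of "cmod \<zeta>"] \<zeta>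
        by (simp add: field_simps)
      ultimately have "cmod (deriv b \<zeta> * g \<zeta> + b \<zeta> * deriv g \<zeta>)
          \<le> cmod (deriv b \<zeta>) * (1 + growth k (disc_weight (cmod \<zeta>))) + cmod (b \<zeta>) * ?D"
        by (intro order_trans[OF norm_triangle_ineq] add_mono)
          (simp_all only: norm_mult mult_left_mono norm_ge_zero)
      then show ?thesis using norm_l[OF \<zeta>] w[OF \<zeta>] by (auto intro!: mult_left_mono)
    qed
    then show ?thesis by (intro bdd_aboveI2)
  qed
  \<comment> \<open>Here \<open>N\<close> is the norm of a functional chosen so that it exceeds 4^n,
    and \<open>g\<close> attains at least three quarters of it.\<close>
  have "\<exists>\<zeta> g N. cmod \<zeta> < 1 \<and> g \<in> G \<and> 4 ^ n \<le> N \<and> 3 / 4 * N \<le> norm (l \<zeta> g) \<and>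
      (\<forall>h\<in>G. norm (l \<zeta> h) \<le> N)" for n :: nat
  proof -
    obtain g0 \<zeta> where \<zeta>: "cmod \<zeta> < 1" and g0: "g0 \<in> G" "4 ^ n < norm (l \<zeta> g0)"
      using unbounded by blast
    define N where "N = (SUP g\<in>G. norm (l \<zeta> g))"
    have upper: "norm (l \<zeta> h) \<le> N" if "h \<in> G" for h
      unfolding N_def by (rule cSUP_upper[OF that bdd[OF \<zeta>]])
    have N: "4 ^ n < N" using upper[OF g0(1)] g0(2) by linarith
    have "3 / 4 * N < N" using N less_trans[of 0 "4 ^ n" N] by simp
    then obtain g where "g \<in> G" "3 / 4 * N < norm (l \<zeta> g)"
      using less_cSUP_iff[OF _ bdd[OF \<zeta>], of "3 / 4 * N"] g0(1) by (auto simp: N_def)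
    then show ?thesis using \<zeta> N upper by (intro exI[of _ \<zeta>] exI[of _ g] exI[of _ N]) auto
  qed
  then obtain z g N where z: "\<And>n. cmod (z n) < 1" and g: "\<And>n. g n \<in> G"
    and N: "\<And>n. 4 ^ n \<le> N n" and large: "\<And>n. 3 / 4 * N n \<le> norm (l (z n) (g n))"
    and upper: "\<And>n h. h \<in> G \<Longrightarrow> norm (l (z n) h) \<le> N n"
    by metis
  obtain \<epsilon> :: "nat \<Rightarrow> real" where \<epsilon>: "\<And>n. \<bar>\<epsilon> n\<bar> = 1"
    and sign: "\<And>n. norm ((1/3) ^ n *\<^sub>R l (z n) (g n))
      \<le> norm (\<Sum>i<Suc n. \<epsilon> i *\<^sub>R ((1/3) ^ i *\<^sub>R l (z n) (g i)))"
    using sign_choice[of "\<lambda>n i. (1/3) ^ i *\<^sub>R l (z n) (g i)"] by blast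
  define c where "c i = \<epsilon> i * (1/3) ^ i" for i
  have abs_c: "\<bar>c i\<bar> = (1/3) ^ i" for i by (simp add: c_def abs_mult \<epsilon>)
  have "summable (\<lambda>i. \<bar>c i\<bar>)" by (simp add: abs_c summable_geometric)
  moreover have "bloch_disc_bound k 1 (g i)" "cmod (g i 0) \<le> 1" for i
    using g[of i] by (auto simp: G_def)
  ultimately obtain f where f: "bloch_disc_bound k (\<Sum>i. \<bar>c i\<bar>) f"
    and fs: "\<And>\<zeta>. cmod \<zeta> < 1 \<Longrightarrow> (\<lambda>i. of_real (c i) * g i \<zeta>) sums f \<zeta>"
    and f's: "\<And>\<zeta>. cmod \<zeta> < 1 \<Longrightarrow> (\<lambda>i. of_real (c i) * deriv (g i) \<zeta>) sums deriv f \<zeta>"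
    using bloch_disc_series[of k g c] by blast
  obtain C' where C': "bloch_disc_bound j C' (\<lambda>\<zeta>. b \<zeta> * f \<zeta>)"
    using mult f by blast
  \<comment> \<open>The n-th term contributes at least 3^(-n) (3/4) \<open>N n\<close> and the later
    ones remove at most (3/2) 3^(-n-1) \<open>N n\<close>, half of 3^(-n) \<open>N n\<close>. What
    remains is 3^(-n) \<open>N n\<close> / 4, at least (4/3)^n / 4.\<close>
  have le: "(4/3) ^ n / 4 \<le> C'" for n
  proof -
    have "(\<lambda>i. of_real (w (z n)) * (deriv b (z n) * (of_real (c i) * g i (z n)) +
        b (z n) * (of_real (c i) * deriv (g i) (z n)))) sums l (z n) f"
      unfolding l_def by (intro sums_mult sums_add fs f's z)
    then have sums: "(\<lambda>i. of_real (c i) * l (z n) (g i)) sums l (z n) f"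
      by (simp add: l_def algebra_simps)
    have tail: "norm (of_real (c (i + Suc n)) * l (z n) (g (i + Suc n)))
        \<le> (1/3) ^ i * ((1/3) ^ Suc n * N n)" for i
    proof -
      have "norm (of_real (c (i + Suc n)) * l (z n) (g (i + Suc n)))
          = (1/3) ^ (i + Suc n) * norm (l (z n) (g (i + Suc n)))"
        by (simp only: norm_mult norm_of_real abs_c)
      also have "\<dots> \<le> (1/3) ^ (i + Suc n) * N n"
        by (intro mult_left_mono upper g) auto
      finally show ?thesis by (simp only: power_add mult.assoc)
    qed
    have geom: "(\<lambda>i. (1/3) ^ i * ((1/3) ^ Suc n * N n)) sums (1 / (1 - 1/3) * ((1/3) ^ Suc n * N n))"
      by (intro sums_mult2 geometric_sums) simp
    define S where "S = (\<Sum>i<Suc n. of_real (c i) * l (z n) (g i))"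
    have "norm S - 1 / (1 - 1/3) * ((1/3) ^ Suc n * N n) \<le> norm (l (z n) f)"
      unfolding S_def by (rule norm_sums_ge_diff[OF sums tail geom])
    moreover have "S = (\<Sum>i<Suc n. \<epsilon> i *\<^sub>R ((1/3) ^ i *\<^sub>R l (z n) (g i)))"
      unfolding S_def by (intro sum.cong) (auto simp: c_def scaleR_conv_of_real)
    moreover have "(1/3) ^ n * (3 / 4 * N n) \<le> norm ((1/3) ^ n *\<^sub>R l (z n) (g n))"
      using large[of n] by (simp add: mult_left_mono)
    ultimately have "(1/3) ^ n * (3 / 4 * N n) - 1 / (1 - 1/3) * ((1/3) ^ Suc n * N n)
        \<le> norm (l (z n) f)"
      using sign[of n] by (simp only:)
    then have "(1/3) ^ n * N n / 4 \<le> norm (l (z n) f)" by (simp add: algebra_simps)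
    moreover have "(1/3) ^ n * 4 ^ n \<le> (1/3) ^ n * N n"
      using N by (intro mult_left_mono) auto
    moreover have "norm (l (z n) f) \<le> C'"
    proof -
      have "b field_differentiable at (z n)" "f field_differentiable at (z n)"
        using b f z by (auto simp: bloch_disc_bound_def holomorphic_on_open field_differentiable_def)
      then have "deriv (\<lambda>\<zeta>. b \<zeta> * f \<zeta>) (z n) = b (z n) * deriv f (z n) + deriv b (z n) * f (z n)"
        by (rule deriv_mult)
      then show ?thesis
        using bloch_disc_boundD[OF C' z, of n] norm_l[OF z] by (simp add: w_def add.commute)
    qed
    ultimately show ?thesis by (simp add: power_mult_distrib[symmetric])
  qed
  obtain n where "4 * C' < (4/3) ^ n"
    using real_arch_pow[of "4/3" "4 * C'"] by auto
  with le[of n] show False by linarith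
qed

subsection \<open>Test functions\<close>

text \<open>Both inequalities between \<open>x\<close> and \<open>y\<close> enter because a negative
  exponent reverses the order; the absolute value in the constant covers both signs.\<close>

lemma powr_le_comparable:
  fixes c x y s :: real
  assumes "0 < x" "0 < y" "x \<le> c * y" "y \<le> c * x" "1 \<le> c"
  shows "x powr s \<le> c powr \<bar>s\<bar> * y powr s"
proof (cases "0 \<le> s")
  case True
  have "x powr s \<le> (c * y) powr s" using assms True by (intro powr_mono2) auto
  then show ?thesis using assms True by (simp add: powr_mult)
next
  case False
  have "(c * x) powr s \<le> y powr s" using assms False by (intro powr_mono2') auto
  then have "c powr s * x powr s \<le> y powr s" using assms by (simp add: powr_mult)
  then show ?thesis using assms False by (simp add: powr_minus field_simps)
qed

text \<open>On the disc |1 - cnj a \<zeta>| is at most 2, so the summand 2 keeps the real part above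
  2 - ln 2 > 1. Hence principal powers and logarithms of \<open>log_test\<close> are holomorphic,
  and its modulus is at least 1.\<close>

definition log_test :: "complex \<Rightarrow> complex \<Rightarrow> complex"
  where "log_test a \<zeta> = 2 - Ln (1 - cnj a * \<zeta>)"

context
  fixes a \<zeta> :: complex
  assumes a: "cmod a < 1" and \<zeta>: "cmod \<zeta> < 1"
begin

lemma norm_cnj_mult_le: "cmod (cnj a * \<zeta>) \<le> cmod a" "cmod (cnj a * \<zeta>) \<le> cmod \<zeta>"
  using a \<zeta> by (auto simp: norm_mult mult_left_le mult_left_le_one_le)

lemma kernel_ge: "1 - cmod \<zeta> \<le> cmod (1 - cnj a * \<zeta>)" "1 - cmod a \<le> cmod (1 - cnj a * \<zeta>)"
  using norm_cnj_mult_le norm_triangle_ineq2[of 1 "cnj a * \<zeta>"] by auto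

lemma kernel_le: "cmod (1 - cnj a * \<zeta>) \<le> 2"
  using norm_cnj_mult_le norm_triangle_ineq4[of 1 "cnj a * \<zeta>"] a by simp

lemma kernel_pos: "0 < cmod (1 - cnj a * \<zeta>)"
  using kernel_ge a by linarith

lemma kernel_Re_pos: "0 < Re (1 - cnj a * \<zeta>)"
  using norm_cnj_mult_le complex_Re_le_cmod[of "cnj a * \<zeta>"] a by simp

lemma Re_log_test: "Re (log_test a \<zeta>) = 2 - ln (cmod (1 - cnj a * \<zeta>))"
  using kernel_pos by (auto simp: log_test_def)

lemma Re_log_test_ge_1: "1 \<le> Re (log_test a \<zeta>)"
proof -
  have "ln (cmod (1 - cnj a * \<zeta>)) \<le> ln 2" using kernel_le kernel_pos by simp
  then show ?thesis using Re_log_test ln_2_less_1 by linarith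
qed

lemma norm_log_test_ge_1: "1 \<le> cmod (log_test a \<zeta>)"
  using Re_log_test_ge_1 complex_Re_le_cmod order_trans by blast

lemma log_test_notin_nonpos_Reals: "log_test a \<zeta> \<notin> \<real>\<^sub>\<le>\<^sub>0"
  using Re_log_test_ge_1 by (auto simp: complex_nonpos_Reals_iff)

text \<open>The kernel 1 - cnj a \<zeta> lies in the right half-plane, so the imaginary part is
  below pi/2 < 2 in modulus. The real part is at most 2 - ln (1 - |\<zeta>|), and the sum stays
  below 4 - ln (1 - |\<zeta>|).\<close>

lemma norm_log_test_le: "cmod (log_test a \<zeta>) \<le> 4 * disc_weight (cmod \<zeta>)"
proof -
  have "cmod (log_test a \<zeta>) \<le> Re (log_test a \<zeta>) + \<bar>Im (log_test a \<zeta>)\<bar>"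
    using cmod_le[of "log_test a \<zeta>"] Re_log_test_ge_1 by simp
  moreover have "\<bar>Im (log_test a \<zeta>)\<bar> < pi / 2"
    using Re_Ln_pos_lt_imp[OF kernel_Re_pos] by (simp add: log_test_def)
  moreover have "ln (1 - cmod \<zeta>) \<le> 0" using \<zeta> by simp
  moreover have "ln (1 - cmod \<zeta>) \<le> ln (cmod (1 - cnj a * \<zeta>))"
    using kernel_ge kernel_pos \<zeta> by (subst ln_le_cancel_iff) auto
  moreover have "x \<le> 4 * (1 - t)"
    if "x \<le> r + i" "i < p / 2" "t \<le> 0" "t \<le> s" "r = 2 - s" "p < 4" for x r i t s p :: real
    using that by (simp add: field_simps)
  ultimately show ?thesis
    using Re_log_test pi_less_4 unfolding disc_weight_def by blast
qed

text \<open>Let h be the real part of the test function and q the quotient of |1 - cnj a \<zeta>| by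
  1 - |\<zeta>|. The weight equals h - 1 + ln q, and ln q \<le> q - 1 \<le> h (q - 1) because h is
  at least 1.\<close>

lemma disc_weight_le_log_test:
  "disc_weight (cmod \<zeta>) \<le> cmod (log_test a \<zeta>) * (cmod (1 - cnj a * \<zeta>) / (1 - cmod \<zeta>))"
proof -
  let ?q = "cmod (1 - cnj a * \<zeta>) / (1 - cmod \<zeta>)"
  let ?h = "Re (log_test a \<zeta>)"
  have q: "1 \<le> ?q" using kernel_ge \<zeta> by simp
  have "ln ?q = ln (cmod (1 - cnj a * \<zeta>)) - ln (1 - cmod \<zeta>)"
    using kernel_pos \<zeta> by (intro ln_divide_pos) auto
  then have "disc_weight (cmod \<zeta>) = ?h - 1 + ln ?q"
    by (simp add: Re_log_test disc_weight_def)
  also have "\<dots> \<le> ?h + 1 * (?q - 1)"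
    using q ln_le_minus_one[of ?q] by simp
  also have "\<dots> \<le> ?h + ?h * (?q - 1)"
    using q Re_log_test_ge_1 by (intro add_left_mono mult_right_mono) auto
  also have "\<dots> = ?h * ?q" by (simp add: algebra_simps)
  also have "\<dots> \<le> cmod (log_test a \<zeta>) * ?q"
    using q by (intro mult_right_mono complex_Re_le_cmod) auto
  finally show ?thesis .
qed

text \<open>The factor q = |1 - cnj a \<zeta>| / (1 - |\<zeta>|), at least 1, is available to be
  lost. For 0 \<le> k \<le> 1 the preceding comparison costs q^k \<le> q; for negative
  \<open>k\<close> the bound by four times the weight costs only a constant.\<close>

lemma log_test_weighted:
  assumes "k \<le> 1"
  shows "(1 - cmod \<zeta>) * disc_weight (cmod \<zeta>) powr k *
    (cmod (log_test a \<zeta>) powr (- k) / cmod (1 - cnj a * \<zeta>)) \<le> 4 powr \<bar>k\<bar>"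
proof -
  let ?w = "disc_weight (cmod \<zeta>)" and ?h = "cmod (log_test a \<zeta>)" and ?t = "1 - cmod \<zeta>"
    and ?R = "cmod (1 - cnj a * \<zeta>)"
  have w: "1 \<le> ?w" using \<zeta> by (intro disc_weight_ge_1) auto
  have h: "0 < ?h" using norm_log_test_ge_1 by linarith
  have t: "0 < ?t" "?t \<le> ?R" "0 < ?R" using \<zeta> kernel_ge kernel_pos by auto
  have "(?w / ?h) powr k \<le> 4 powr \<bar>k\<bar> * (?R / ?t)"
  proof (cases "0 \<le> k")
    case True
    have "?w / ?h \<le> ?R / ?t"
      using h disc_weight_le_log_test by (simp only: pos_divide_le_eq mult.commute)
    then have "(?w / ?h) powr k \<le> (?R / ?t) powr k"
      using True w by (intro powr_mono2) auto
    also have "\<dots> \<le> (?R / ?t) powr 1"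
      using t assms by (intro powr_mono) auto
    also have "\<dots> \<le> 4 powr \<bar>k\<bar> * (?R / ?t)"
      using t ge_one_powr_ge_zero[of 4 "\<bar>k\<bar>"] mult_right_mono[of 1 "4 powr \<bar>k\<bar>" "?R / ?t"] by simp
    finally show ?thesis .
  next
    case False
    have "1 / 4 \<le> ?w / ?h"
      using norm_log_test_le by (simp add: pos_le_divide_eq[OF h])
    then have "(?w / ?h) powr k \<le> (1/4) powr k"
      using False by (intro powr_mono2') auto
    also have "\<dots> = 4 powr \<bar>k\<bar>" using False by (simp add: powr_divide powr_minus field_simps)
    also have "\<dots> \<le> 4 powr \<bar>k\<bar> * (?R / ?t)"
      using t mult_left_mono[of 1 "?R / ?t" "4 powr \<bar>k\<bar>"] by simp
    finally show ?thesis .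
  qed
  moreover have "(?w / ?h) powr k = ?w powr k * ?h powr (- k)"
    using w h by (simp add: powr_divide powr_minus_divide)
  ultimately show ?thesis using t by (simp add: field_simps)
qed

lemma log_test_has_field_derivative:
  "(log_test a has_field_derivative cnj a / (1 - cnj a * \<zeta>)) (at \<zeta>)"
proof -
  have "1 - cnj a * \<zeta> \<notin> \<real>\<^sub>\<le>\<^sub>0"
    using kernel_Re_pos by (auto simp: complex_nonpos_Reals_iff)
  then show ?thesis
    unfolding log_test_def[abs_def] by (auto intro!: derivative_eq_intros simp: field_simps)
qed

text \<open>Up to the factor \<open>1 - k\<close>, the function inside is the derivative of the
  power 1 - k of \<open>log_test a\<close>; for \<open>k = 1\<close> it is that of its
  logarithm.\<close>

lemma log_test_weighted_deriv:
  assumes "k \<le> 1"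
  shows "(1 - cmod \<zeta>) * disc_weight (cmod \<zeta>) powr k *
    cmod (log_test a \<zeta> powr (- of_real k) * (cnj a / (1 - cnj a * \<zeta>))) \<le> 4 powr \<bar>k\<bar>"
proof -
  have "(1 - cmod \<zeta>) * disc_weight (cmod \<zeta>) powr k *
      cmod (log_test a \<zeta> powr (- of_real k) * (cnj a / (1 - cnj a * \<zeta>)))
      = cmod a * ((1 - cmod \<zeta>) * disc_weight (cmod \<zeta>) powr k *
        (cmod (log_test a \<zeta>) powr (- k) / cmod (1 - cnj a * \<zeta>)))"
    by (simp add: norm_mult norm_divide norm_powr_real_powr')
  also have "\<dots> \<le> 1 * ((1 - cmod \<zeta>) * disc_weight (cmod \<zeta>) powr k *
        (cmod (log_test a \<zeta>) powr (- k) / cmod (1 - cnj a * \<zeta>)))"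
    using a \<zeta> by (intro mult_right_mono) auto
  finally show ?thesis using log_test_weighted[OF assms] by simp
qed

end

lemma log_test_0 [simp]: "log_test a 0 = 2"
  by (simp add: log_test_def)

lemma kernel_diag:
  assumes "cmod a < 1"
  shows "cmod (1 - cnj a * a) = (1 - cmod a) * (1 + cmod a)"
proof -
  have "1 - cnj a * a = of_real (1 - (cmod a)\<^sup>2)"
    using complex_norm_square[of a] by (simp add: mult.commute)
  moreover have "0 \<le> 1 - (cmod a)\<^sup>2" using assms by (simp add: power_le_one)
  ultimately have "cmod (1 - cnj a * a) = 1 - (cmod a)\<^sup>2" by (simp only: norm_of_real abs_of_nonneg)
  then show ?thesis by (simp add: power2_eq_square algebra_simps)
qed

text \<open>At \<zeta> = a the kernel is (1 - |a|)(1 + |a|). The second factor costs a logarithm of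
  at most 1, which the constant 2 in \<open>log_test\<close> pays for.\<close>

lemma disc_weight_le_log_test_diag:
  assumes "cmod a < 1"
  shows "disc_weight (cmod a) \<le> cmod (log_test a a)"
proof -
  have "0 < 1 - cmod a" "0 < 1 + cmod a" using assms norm_ge_zero[of a] by linarith+
  moreover have "ln (1 + cmod a) \<le> 1" using ln_add_one_self_le_self[of "cmod a"] assms by simp
  ultimately have "disc_weight (cmod a) \<le> Re (log_test a a)"
    using assms by (simp add: Re_log_test kernel_diag ln_mult_pos disc_weight_def)
  then show ?thesis using complex_Re_le_cmod order_trans by blast
qed

text \<open>The order of \<open>growth\<close>, modified to be at least 1 so that additive constants
  are absorbed. It is the extra weight that a multiplier's derivative must carry, and it expresses
  the three cases of the theorem at once.\<close>

definition growth_scale :: "real \<Rightarrow> real \<Rightarrow> real"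
  where "growth_scale k x = (if k < 1 then x powr (1 - k) else if k = 1 then 1 + ln x else 1)"

lemma growth_scale_ge_1: "1 \<le> x \<Longrightarrow> 1 \<le> growth_scale k x"
  by (auto simp: growth_scale_def ge_one_powr_ge_zero)

lemma growth_le_growth_scale:
  obtains A where "0 \<le> A" "\<And>x. 1 \<le> x \<Longrightarrow> growth k x \<le> A * growth_scale k x"
proof -
  consider "k < 1" | "k = 1" | "1 < k" by linarith
  then show ?thesis
  proof cases
    case 1
    then show ?thesis
      using growth_less_1[OF 1] by (intro that[of "1 / (1 - k)"]) (auto simp: growth_scale_def)
  next
    case 2
    then show ?thesis by (intro that[of 1]) (auto simp: growth_scale_def growth_def)
  next
    case 3
    then show ?thesis
      using growth_greater_1[OF 3] by (intro that[of "1 / (k - 1)"]) (auto simp: growth_scale_def)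
  qed
qed

lemma bloch_disc_bound_scaled_growth:
  assumes "bloch_disc_bound k C g"
  obtains A where "\<And>\<zeta>. cmod \<zeta> < 1 \<Longrightarrow> cmod (g \<zeta>) \<le> A * growth_scale k (disc_weight (cmod \<zeta>))"
proof -
  obtain A where A: "0 \<le> A" "\<And>x. 1 \<le> x \<Longrightarrow> growth k x \<le> A * growth_scale k x"
    using growth_le_growth_scale by blast
  have "cmod (g \<zeta>) \<le> (cmod (g 0) + C * A) * growth_scale k (disc_weight (cmod \<zeta>))"
    if \<zeta>: "cmod \<zeta> < 1" for \<zeta>
  proof -
    let ?w = "disc_weight (cmod \<zeta>)"
    have w: "1 \<le> ?w" using \<zeta> by (intro disc_weight_ge_1) auto
    have "cmod (g \<zeta>) \<le> cmod (g 0) * 1 + C * growth k ?w"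
      using bloch_disc_growth[OF assms \<zeta>] by simp
    also have "\<dots> \<le> cmod (g 0) * growth_scale k ?w + C * (A * growth_scale k ?w)"
      using A(2)[OF w] growth_scale_ge_1[OF w] bloch_disc_bound_nonneg[OF assms]
      by (intro add_mono mult_left_mono) auto
    finally show ?thesis by (simp add: algebra_simps)
  qed
  then show ?thesis by (rule that)
qed

lemma bloch_disc_bound_cmult:
  assumes "bloch_disc_bound s C g"
  shows "bloch_disc_bound s (cmod c * C) (\<lambda>\<zeta>. c * g \<zeta>)"
  unfolding bloch_disc_bound_def
proof (intro conjI ballI)
  show "(\<lambda>\<zeta>. c * g \<zeta>) holomorphic_on ball 0 1"
    using assms by (auto simp: bloch_disc_bound_def intro!: holomorphic_intros)
  fix \<zeta> :: complex assume "\<zeta> \<in> ball 0 1"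
  then have \<zeta>: "cmod \<zeta> < 1" by simp
  have "deriv (\<lambda>\<zeta>. c * g \<zeta>) \<zeta> = c * deriv g \<zeta>"
    using bloch_disc_bound_deriv[OF assms \<zeta>] by (intro DERIV_imp_deriv DERIV_cmult)
  then show "(1 - cmod \<zeta>) * disc_weight (cmod \<zeta>) powr s * cmod (deriv (\<lambda>\<zeta>. c * g \<zeta>) \<zeta>) \<le> cmod c * C"
    using mult_left_mono[OF bloch_disc_boundD[OF assms \<zeta>], of "cmod c"]
    by (simp add: norm_mult mult_ac)
qed

lemma bloch_disc_boundI:
  assumes "\<And>\<zeta>. cmod \<zeta> < 1 \<Longrightarrow> (g has_field_derivative g' \<zeta>) (at \<zeta>)"
    and "\<And>\<zeta>. cmod \<zeta> < 1 \<Longrightarrow> (1 - cmod \<zeta>) * disc_weight (cmod \<zeta>) powr s * cmod (g' \<zeta>) \<le> C"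
  shows "bloch_disc_bound s C g"
proof -
  have "g holomorphic_on ball 0 1"
    using assms(1) by (metis holomorphic_on_open mem_ball_0 open_ball)
  moreover have "deriv g \<zeta> = g' \<zeta>" if "cmod \<zeta> < 1" for \<zeta>
    using assms(1)[OF that] by (rule DERIV_imp_deriv)
  ultimately show ?thesis using assms(2) by (auto simp: bloch_disc_bound_def)
qed

text \<open>Functions of maximal growth at \<open>a\<close>, with a constant independent of
  \<open>a\<close>: \<open>1 + Ln\<close> of \<open>log_test a\<close> for \<open>k = 1\<close>, its
  power 1 - k otherwise. The diagonal estimate gives the lower bound.\<close>

lemma bloch_disc_test_large:
  assumes "k \<le> 1"
  obtains C where "0 < C" "\<And>a. cmod a < 1 \<Longrightarrow> \<exists>g. bloch_disc_bound k C g \<and> cmod (g 0) \<le> C \<and>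
    growth_scale k (disc_weight (cmod a)) \<le> cmod (g a)"
proof (cases "k = 1")
  case True
  have "\<exists>g. bloch_disc_bound k 4 g \<and> cmod (g 0) \<le> 4 \<and>
    growth_scale k (disc_weight (cmod a)) \<le> cmod (g a)" if a: "cmod a < 1" for a
  proof (intro exI conjI)
    let ?g = "\<lambda>\<zeta>. 1 + Ln (log_test a \<zeta>)"
    show "bloch_disc_bound k 4 ?g"
    proof (rule bloch_disc_boundI)
      fix \<zeta> assume \<zeta>: "cmod \<zeta> < 1"
      show "(?g has_field_derivative log_test a \<zeta> powr (- of_real k) * (cnj a / (1 - cnj a * \<zeta>))) (at \<zeta>)"
        using log_test_notin_nonpos_Reals[OF a \<zeta>] norm_log_test_ge_1[OF a \<zeta>] True
        by (auto intro!: derivative_eq_intros log_test_has_field_derivative[OF a \<zeta>]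
            simp: powr_minus inverse_eq_divide)
      show "(1 - cmod \<zeta>) * disc_weight (cmod \<zeta>) powr k *
          cmod (log_test a \<zeta> powr (- of_real k) * (cnj a / (1 - cnj a * \<zeta>))) \<le> 4"
        using log_test_weighted_deriv[OF a \<zeta> assms] True by simp
    qed
    have "cmod (?g 0) \<le> 1 + cmod (Ln 2)" by (simp add: norm_triangle_le)
    then show "cmod (?g 0) \<le> 4" using ln_2_less_1 Ln_of_real[of 2] by simp
    have h: "0 < cmod (log_test a a)" using norm_log_test_ge_1[OF a a] by linarith
    then have "1 + ln (cmod (log_test a a)) = Re (?g a)" by auto
    moreover have "ln (disc_weight (cmod a)) \<le> ln (cmod (log_test a a))"
      using disc_weight_le_log_test_diag[OF a] disc_weight_ge_1[of "cmod a"] a h by simp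
    ultimately show "growth_scale k (disc_weight (cmod a)) \<le> cmod (?g a)"
      using True complex_Re_le_cmod[of "?g a"] by (simp add: growth_scale_def)
  qed
  then show ?thesis using that[of 4] by simp
next
  case False
  \<comment> \<open>The first summand bounds the weighted derivative, with 1 - k from the chain
    rule; the second is the modulus at 0, since \<open>log_test a 0 = 2\<close>.\<close>
  define C where "C = 4 powr \<bar>k\<bar> * (1 - k) + 2 powr (1 - k)"
  have "\<exists>g. bloch_disc_bound k C g \<and> cmod (g 0) \<le> C \<and>
    growth_scale k (disc_weight (cmod a)) \<le> cmod (g a)" if a: "cmod a < 1" for a
  proof (intro exI conjI)
    let ?g = "\<lambda>\<zeta>. log_test a \<zeta> powr of_real (1 - k)"
    let ?d = "\<lambda>\<zeta>. log_test a \<zeta> powr (- of_real k) * (cnj a / (1 - cnj a * \<zeta>))"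
    show "bloch_disc_bound k C ?g"
    proof (rule bloch_disc_boundI)
      fix \<zeta> assume \<zeta>: "cmod \<zeta> < 1"
      have "(?g has_field_derivative (of_real (1 - k) * log_test a \<zeta> powr (of_real (1 - k) - 1))
          * (cnj a / (1 - cnj a * \<zeta>))) (at \<zeta>)"
        by (rule DERIV_chain2[where f="\<lambda>z. z powr of_real (1 - k)" and g="log_test a"])
          (use has_field_derivative_powr log_test_notin_nonpos_Reals[OF a \<zeta>]
            log_test_has_field_derivative[OF a \<zeta>] in blast)+
      then show "(?g has_field_derivative of_real (1 - k) * ?d \<zeta>) (at \<zeta>)"
        by (simp add: mult.assoc)
      have "(1 - cmod \<zeta>) * disc_weight (cmod \<zeta>) powr k * cmod (?d \<zeta>) * (1 - k) \<le> 4 powr \<bar>k\<bar> * (1 - k)"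
        using log_test_weighted_deriv[OF a \<zeta> assms] assms by (intro mult_right_mono) auto
      also have "\<dots> \<le> C" by (simp add: C_def)
      moreover have "cmod (of_real (1 - k) * ?d \<zeta>) = (1 - k) * cmod (?d \<zeta>)"
        unfolding norm_mult[of "of_real (1 - k)"] norm_of_real using assms by simp
      ultimately show "(1 - cmod \<zeta>) * disc_weight (cmod \<zeta>) powr k * cmod (of_real (1 - k) * ?d \<zeta>) \<le> C"
        by (simp only: mult_ac)
    qed
    show "cmod (?g 0) \<le> C"
      using assms norm_powr_real_powr'[of "of_real (1 - k)" 2] by (simp add: C_def)
    have "disc_weight (cmod a) powr (1 - k) \<le> cmod (log_test a a) powr (1 - k)"
      using disc_weight_le_log_test_diag[OF a] disc_weight_ge_1[of "cmod a"] a assms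
      by (intro powr_mono2) auto
    also have "\<dots> = cmod (?g a)"
      using norm_powr_real_powr'[of "of_real (1 - k)" "log_test a a"] by simp
    finally show "growth_scale k (disc_weight (cmod a)) \<le> cmod (?g a)"
      using assms False by (simp add: growth_scale_def)
  qed
  moreover have "0 < C" using assms by (auto simp: C_def intro!: add_nonneg_pos)
  ultimately show ?thesis using that by blast
qed

text \<open>A Moebius factor vanishing at \<open>a\<close> times the power -k of
  \<open>log_test a\<close>. At \<open>a\<close> only the derivative of the Moebius factor, 1 / (1 -
  |a|^2), survives, and on the diagonal \<open>log_test\<close> is comparable to the weight, so the
  weighted derivative is bounded below.\<close>

lemma bloch_disc_test_vanishing:
  assumes "k \<le> 1"
  obtains C where "0 < C" "\<And>a. cmod a < 1 \<Longrightarrow> \<exists>g. bloch_disc_bound k C g \<and> cmod (g 0) \<le> C \<and>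
    g a = 0 \<and> 1 \<le> (1 - cmod a) * disc_weight (cmod a) powr k * cmod (deriv g a) * C"
proof -
  \<comment> \<open>In order: a bound for the term with the derivative of the Moebius factor, one
    for the term with the derivative of the power, and one for the value at 0.\<close>
  define C where "C = 2 * 4 powr \<bar>k\<bar> + \<bar>k\<bar> * 4 powr \<bar>k\<bar> + 2 powr (- k)"
  have "\<exists>g. bloch_disc_bound k C g \<and> cmod (g 0) \<le> C \<and> g a = 0 \<and>
    1 \<le> (1 - cmod a) * disc_weight (cmod a) powr k * cmod (deriv g a) * C"
    if a: "cmod a < 1" for a
  proof (intro exI conjI)
    let ?u = "\<lambda>\<zeta>. 1 - cnj a * \<zeta>"
    let ?m = "\<lambda>\<zeta>. (\<zeta> - a) / ?u \<zeta>" and ?p = "\<lambda>\<zeta>. log_test a \<zeta> powr (- of_real k)"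
    let ?m' = "\<lambda>\<zeta>. (1 - cnj a * a) / (?u \<zeta>)\<^sup>2"
    let ?g = "\<lambda>\<zeta>. ?m \<zeta> * ?p \<zeta>"
    let ?d = "\<lambda>\<zeta>. ?p \<zeta> * (cnj a / ?u \<zeta>)"
    let ?g' = "\<lambda>\<zeta>. ?m' \<zeta> * ?p \<zeta>
      + ?m \<zeta> * (- of_real k / log_test a \<zeta> * ?d \<zeta>)"
    have der: "(?g has_field_derivative ?g' \<zeta>) (at \<zeta>)" if \<zeta>: "cmod \<zeta> < 1" for \<zeta>
    proof -
      have nz: "?u \<zeta> \<noteq> 0" "log_test a \<zeta> \<noteq> 0"
        using kernel_pos[OF a \<zeta>] norm_log_test_ge_1[OF a \<zeta>] by auto
      have "(?m has_field_derivative ?m' \<zeta>) (at \<zeta>)"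
        using nz by (auto intro!: derivative_eq_intros simp: power2_eq_square field_simps)
      moreover have "(?p has_field_derivative
          (- of_real k * log_test a \<zeta> powr (- of_real k - 1)) * (cnj a / ?u \<zeta>)) (at \<zeta>)"
        by (rule DERIV_chain2[where f="\<lambda>z. z powr (- of_real k)" and g="log_test a"])
          (use has_field_derivative_powr log_test_notin_nonpos_Reals[OF a \<zeta>]
            log_test_has_field_derivative[OF a \<zeta>] in blast)+
      ultimately have "(?g has_field_derivative ?m' \<zeta> * ?p \<zeta> +
          (- of_real k * log_test a \<zeta> powr (- of_real k - 1)) * (cnj a / ?u \<zeta>) * ?m \<zeta>) (at \<zeta>)"
        by (rule DERIV_mult)
      moreover have "log_test a \<zeta> powr (- of_real k - 1) = ?p \<zeta> / log_test a \<zeta>"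
        using nz by (simp add: powr_diff)
      ultimately show ?thesis
        by (simp only: divide_inverse mult_ac)
    qed
    show "bloch_disc_bound k C ?g"
    proof (rule bloch_disc_boundI)
      fix \<zeta> assume \<zeta>: "cmod \<zeta> < 1"
      show "(?g has_field_derivative ?g' \<zeta>) (at \<zeta>)" by (rule der[OF \<zeta>])
      define t where "t = (1 - cmod \<zeta>) * disc_weight (cmod \<zeta>) powr k"
      have t: "0 \<le> t" using \<zeta> by (simp add: t_def)
      have R: "0 < cmod (?u \<zeta>)" by (rule kernel_pos[OF a \<zeta>])
      \<comment> \<open>Since 1 - |a| is at most the modulus of the kernel, the derivative of the
        Moebius factor is at most 2 over that modulus, which \<open>log_test_weighted\<close> can
        handle.\<close>
      have "cmod (1 - cnj a * a) \<le> cmod (?u \<zeta>) * 2"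
        unfolding kernel_diag[OF a] using a kernel_ge[OF a \<zeta>] by (intro mult_mono) auto
      then have "cmod (1 - cnj a * a) / (cmod (?u \<zeta>) * cmod (?u \<zeta>))
          \<le> cmod (?u \<zeta>) * 2 / (cmod (?u \<zeta>) * cmod (?u \<zeta>))"
        by (intro divide_right_mono) auto
      then have "cmod (?m' \<zeta>) \<le> 2 / cmod (?u \<zeta>)"
        using R by (simp add: norm_divide norm_mult power2_eq_square)
      then have "t * cmod (?m' \<zeta> * ?p \<zeta>) \<le> t * (2 / cmod (?u \<zeta>) * cmod (?p \<zeta>))"
        using t by (simp only: norm_mult mult_left_mono mult_right_mono norm_ge_zero)
      also have "\<dots> \<le> 2 * 4 powr \<bar>k\<bar>"
        using mult_left_mono[OF log_test_weighted[OF a \<zeta> assms], of 2]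
        by (simp add: t_def norm_powr_real_powr' mult_ac)
      finally have 1: "t * cmod (?m' \<zeta> * ?p \<zeta>) \<le> 2 * 4 powr \<bar>k\<bar>" .
      have "cmod (?m \<zeta>) \<le> 1"
        using Moebius_function_norm_lt_1[OF a \<zeta>, of 0] by (simp add: Moebius_function_simple)
      moreover have "cmod (- of_real k / log_test a \<zeta>) \<le> \<bar>k\<bar>"
        using norm_log_test_ge_1[OF a \<zeta>] by (simp add: norm_divide divide_le_eq mult_le_cancel_left1)
      ultimately have "cmod (?m \<zeta>) * cmod (- of_real k / log_test a \<zeta>) * (t * cmod (?d \<zeta>))
          \<le> 1 * \<bar>k\<bar> * 4 powr \<bar>k\<bar>"
        using log_test_weighted_deriv[OF a \<zeta> assms] t by (intro mult_mono) (auto simp: t_def)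
      then have 2: "t * cmod (?m \<zeta> * (- of_real k / log_test a \<zeta> * ?d \<zeta>)) \<le> \<bar>k\<bar> * 4 powr \<bar>k\<bar>"
        by (simp only: norm_mult mult_ac mult_1)
      have "t * cmod (?g' \<zeta>) \<le> t * cmod (?m' \<zeta> * ?p \<zeta>)
          + t * cmod (?m \<zeta> * (- of_real k / log_test a \<zeta> * ?d \<zeta>))"
        using mult_left_mono[OF norm_triangle_ineq t] by (simp only: distrib_left)
      also have "\<dots> \<le> C" using 1 2 powr_ge_zero[of 2 "- k"] by (simp only: C_def)
      finally show "(1 - cmod \<zeta>) * disc_weight (cmod \<zeta>) powr k * cmod (?g' \<zeta>) \<le> C"
        by (simp only: t_def)
    qed
    show "?g a = 0" by simp
    have "cmod (?g 0) = cmod a * 2 powr (- k)"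
      using norm_powr_real_powr'[of "of_real (- k)" 2] by (simp add: norm_mult)
    also have "\<dots> \<le> 1 * 2 powr (- k)" using a by (intro mult_right_mono) auto
    also have "\<dots> \<le> C" by (simp add: C_def)
    finally show "cmod (?g 0) \<le> C" .
    have "deriv ?g a = ?p a / ?u a"
      using DERIV_imp_deriv[OF der[OF a]] kernel_pos[OF a a] by (simp add: power2_eq_square)
    moreover have "cmod (?p a) = cmod (log_test a a) powr (- k)"
      by (simp add: norm_powr_real_powr')
    ultimately have dg: "cmod (deriv ?g a) = cmod (log_test a a) powr (- k) / ((1 - cmod a) * (1 + cmod a))"
      by (simp only: norm_divide kernel_diag[OF a])
    define w where "w = disc_weight (cmod a)"
    define h where "h = cmod (log_test a a)"
    have w: "1 \<le> w" unfolding w_def using a by (intro disc_weight_ge_1) auto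
    have h: "w \<le> h" "h \<le> 4 * w"
      using disc_weight_le_log_test_diag[OF a] norm_log_test_le[OF a a] by (simp_all add: w_def h_def)
    \<comment> \<open>Replacing the weight by \<open>h\<close> costs 4^|k|, and 2 bounds 1 + |a|;
      the first summand of \<open>C\<close> pays for both.\<close>
    have "1 = w powr k * w powr (- k)" using w by (simp add: powr_minus)
    also have "\<dots> \<le> w powr k * (4 powr \<bar>- k\<bar> * h powr (- k))"
      using w h by (intro mult_left_mono powr_le_comparable) auto
    also have "\<dots> = w powr k * h powr (- k) / 2 * (2 * 4 powr \<bar>k\<bar>)" by simp
    also have "\<dots> \<le> w powr k * h powr (- k) / (1 + cmod a) * C"
      using a by (intro mult_mono divide_left_mono) (auto simp: C_def add_pos_nonneg)
    also have "\<dots> = (1 - cmod a) * w powr k * cmod (deriv ?g a) * C"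
      unfolding dg h_def using a by simp
    finally show "1 \<le> (1 - cmod a) * disc_weight (cmod a) powr k * cmod (deriv ?g a) * C"
      by (simp only: w_def)
  qed
  moreover have "0 < C" by (auto simp: C_def intro!: add_nonneg_pos)
  ultimately show ?thesis using that by blast
qed

subsection \<open>Multipliers on the disc\<close>

text \<open>In the product rule, the growth of \<open>f\<close> matches \<open>growth_scale\<close>
  in the term with b', and the term with f' is split by L^j = L^(j-k) L^k, where L is the
  weight.\<close>

lemma bloch_disc_multiplier_sufficient:
  assumes b: "b holomorphic_on ball 0 1" and f: "bloch_disc_bound k C f"
    and b': "\<And>\<zeta>. cmod \<zeta> < 1 \<Longrightarrow> (1 - cmod \<zeta>) * (disc_weight (cmod \<zeta>) powr j *
      growth_scale k (disc_weight (cmod \<zeta>))) * cmod (deriv b \<zeta>) \<le> C1"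
    and b0: "\<And>\<zeta>. cmod \<zeta> < 1 \<Longrightarrow> cmod (b \<zeta>) * disc_weight (cmod \<zeta>) powr (j - k) \<le> C2"
  shows "\<exists>C'. bloch_disc_bound j C' (\<lambda>\<zeta>. b \<zeta> * f \<zeta>)"
proof -
  obtain A where A: "\<And>\<zeta>. cmod \<zeta> < 1 \<Longrightarrow> cmod (f \<zeta>) \<le> A * growth_scale k (disc_weight (cmod \<zeta>))"
    using bloch_disc_bound_scaled_growth[OF f] by blast
  have "bloch_disc_bound j (\<bar>A\<bar> * C1 + C2 * C) (\<lambda>\<zeta>. b \<zeta> * f \<zeta>)"
  proof (rule bloch_disc_boundI)
    fix \<zeta> assume \<zeta>: "cmod \<zeta> < 1"
    have "(b has_field_derivative deriv b \<zeta>) (at \<zeta>)"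
      using b \<zeta> by (intro holomorphic_derivI[of b "ball 0 1"]) auto
    then show "((\<lambda>\<zeta>. b \<zeta> * f \<zeta>) has_field_derivative deriv b \<zeta> * f \<zeta> + deriv f \<zeta> * b \<zeta>) (at \<zeta>)"
      using bloch_disc_bound_deriv[OF f \<zeta>] by (rule DERIV_mult)
    define w where "w = disc_weight (cmod \<zeta>)"
    define t where "t = 1 - cmod \<zeta>"
    have w: "1 \<le> w" unfolding w_def using \<zeta> by (intro disc_weight_ge_1) auto
    have t: "0 < t" using \<zeta> by (simp add: t_def)
    have "A * growth_scale k w \<le> \<bar>A\<bar> * growth_scale k w"
      using growth_scale_ge_1[OF w, of k] by (intro mult_right_mono) auto
    then have "cmod (f \<zeta>) \<le> \<bar>A\<bar> * growth_scale k w"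
      using A[OF \<zeta>] by (simp add: w_def)
    then have "t * w powr j * cmod (deriv b \<zeta> * f \<zeta>) \<le> t * w powr j * (cmod (deriv b \<zeta>) * (\<bar>A\<bar> * growth_scale k w))"
      using t by (simp add: norm_mult mult_left_mono)
    also have "\<dots> = \<bar>A\<bar> * (t * (w powr j * growth_scale k w) * cmod (deriv b \<zeta>))" by simp
    also have "\<dots> \<le> \<bar>A\<bar> * C1"
      using b'[OF \<zeta>] by (intro mult_left_mono) (auto simp: w_def t_def)
    finally have 1: "t * w powr j * cmod (deriv b \<zeta> * f \<zeta>) \<le> \<bar>A\<bar> * C1" .
    have "t * w powr j * cmod (deriv f \<zeta> * b \<zeta>)
        = (cmod (b \<zeta>) * w powr (j - k)) * (t * w powr k * cmod (deriv f \<zeta>))"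
      using w by (simp add: norm_mult powr_diff)
    also have "\<dots> \<le> C2 * C"
      using b0[OF \<zeta>] bloch_disc_boundD[OF f \<zeta>] t w
      by (intro mult_mono order_trans[OF _ b0[OF \<zeta>]]) (auto simp: w_def t_def)
    finally have 2: "t * w powr j * cmod (deriv f \<zeta> * b \<zeta>) \<le> C2 * C" .
    have "t * w powr j * cmod (deriv b \<zeta> * f \<zeta> + deriv f \<zeta> * b \<zeta>)
        \<le> t * w powr j * (cmod (deriv b \<zeta> * f \<zeta>) + cmod (deriv f \<zeta> * b \<zeta>))"
      using t by (intro mult_left_mono norm_triangle_ineq) auto
    then have "t * w powr j * cmod (deriv b \<zeta> * f \<zeta> + deriv f \<zeta> * b \<zeta>) \<le> \<bar>A\<bar> * C1 + C2 * C"
      using 1 2 by (simp add: distrib_left)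
    then show "(1 - cmod \<zeta>) * disc_weight (cmod \<zeta>) powr j *
        cmod (deriv b \<zeta> * f \<zeta> + deriv f \<zeta> * b \<zeta>) \<le> \<bar>A\<bar> * C1 + C2 * C"
      by (simp add: t_def w_def)
  qed
  then show ?thesis by blast
qed

text \<open>For \<open>1 < k\<close> the growth of a function of order \<open>j\<close> is already
  compensated by the power j - k of the weight, so the Bloch condition implies the one on the
  values.\<close>

lemma bloch_disc_bound_weighted_value:
  assumes "j \<le> k" "1 < k" and b: "bloch_disc_bound j C b"
  obtains C' where
    "\<And>\<zeta>. cmod \<zeta> < 1 \<Longrightarrow> cmod (b \<zeta>) * disc_weight (cmod \<zeta>) powr (j - k) \<le> C'"
proof -
  obtain A where A: "\<And>x. 1 \<le> x \<Longrightarrow> growth j x * x powr (j - k) \<le> A"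
    using growth_times_powr_bounded assms by blast
  have "cmod (b \<zeta>) * disc_weight (cmod \<zeta>) powr (j - k) \<le> cmod (b 0) + C * A"
    if \<zeta>: "cmod \<zeta> < 1" for \<zeta>
  proof -
    define w where "w = disc_weight (cmod \<zeta>)"
    have w: "1 \<le> w" unfolding w_def using \<zeta> by (intro disc_weight_ge_1) auto
    have "cmod (b \<zeta>) * w powr (j - k) \<le> (cmod (b 0) + C * growth j w) * w powr (j - k)"
      using bloch_disc_growth[OF b \<zeta>] by (intro mult_right_mono) (auto simp: w_def)
    also have "\<dots> = cmod (b 0) * w powr (j - k) + C * (growth j w * w powr (j - k))"
      by (simp add: algebra_simps)
    also have "\<dots> \<le> cmod (b 0) * w powr 0 + C * A"
      using w assms A[OF w] bloch_disc_bound_nonneg[OF b]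
      by (intro add_mono mult_left_mono powr_mono) auto
    finally show ?thesis using w by (simp add: w_def)
  qed
  then show ?thesis by (rule that)
qed

text \<open>Homogeneity, so that test functions bounded by a constant other than 1 can be
  used.\<close>

lemma bloch_disc_multiplier_uniform_scaled:
  assumes b: "b holomorphic_on ball 0 1"
    and mult: "\<forall>g C. bloch_disc_bound k C g \<longrightarrow> (\<exists>C'. bloch_disc_bound j C' (\<lambda>\<zeta>. b \<zeta> * g \<zeta>))"
  obtains M where "\<And>C g \<zeta>. 0 < C \<Longrightarrow> bloch_disc_bound k C g \<Longrightarrow> cmod (g 0) \<le> C \<Longrightarrow> cmod \<zeta> < 1 \<Longrightarrow>
    (1 - cmod \<zeta>) * disc_weight (cmod \<zeta>) powr j * cmod (deriv b \<zeta> * g \<zeta> + b \<zeta> * deriv g \<zeta>) \<le> M * C"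
proof -
  obtain M where M: "\<And>g \<zeta>. bloch_disc_bound k 1 g \<Longrightarrow> cmod (g 0) \<le> 1 \<Longrightarrow> cmod \<zeta> < 1 \<Longrightarrow>
    (1 - cmod \<zeta>) * disc_weight (cmod \<zeta>) powr j * cmod (deriv b \<zeta> * g \<zeta> + b \<zeta> * deriv g \<zeta>) \<le> M"
    using bloch_disc_multiplier_uniform[OF assms] by blast
  have "(1 - cmod \<zeta>) * disc_weight (cmod \<zeta>) powr j * cmod (deriv b \<zeta> * g \<zeta> + b \<zeta> * deriv g \<zeta>) \<le> M * C"
    if C: "0 < C" and g: "bloch_disc_bound k C g" "cmod (g 0) \<le> C" and \<zeta>: "cmod \<zeta> < 1" for C g \<zeta>
  proof -
    let ?c = "of_real (1 / C) :: complex"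
    define w where "w = (1 - cmod \<zeta>) * disc_weight (cmod \<zeta>) powr j"
    have "bloch_disc_bound k 1 (\<lambda>\<zeta>. ?c * g \<zeta>)"
      using bloch_disc_bound_cmult[OF g(1), of ?c] C by (simp add: norm_divide)
    moreover have "cmod (?c * g 0) \<le> 1" using C g(2) by (simp add: norm_divide norm_mult)
    moreover have "deriv (\<lambda>\<zeta>. ?c * g \<zeta>) \<zeta> = ?c * deriv g \<zeta>"
      using bloch_disc_bound_deriv[OF g(1) \<zeta>] by (intro DERIV_imp_deriv DERIV_cmult)
    ultimately have "w * cmod (deriv b \<zeta> * (?c * g \<zeta>) + b \<zeta> * (?c * deriv g \<zeta>)) \<le> M"
      using M[OF _ _ \<zeta>, of "\<lambda>\<zeta>. ?c * g \<zeta>"] by (simp add: w_def)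
    moreover have "deriv b \<zeta> * (?c * g \<zeta>) + b \<zeta> * (?c * deriv g \<zeta>)
        = ?c * (deriv b \<zeta> * g \<zeta> + b \<zeta> * deriv g \<zeta>)" by (simp add: algebra_simps)
    ultimately have "w * (cmod (deriv b \<zeta> * g \<zeta> + b \<zeta> * deriv g \<zeta>) / C) \<le> M"
      using C by (simp add: norm_mult norm_divide)
    then show ?thesis using C by (simp add: w_def field_simps)
  qed
  then show ?thesis by (rule that)
qed

theorem bloch_disc_multiplier_iff:
  assumes "j \<le> k" and b: "b holomorphic_on ball 0 1"
  shows "(\<forall>g C. bloch_disc_bound k C g \<longrightarrow> (\<exists>C'. bloch_disc_bound j C' (\<lambda>\<zeta>. b \<zeta> * g \<zeta>))) \<longleftrightarrow>
    (\<exists>C. \<forall>\<zeta>\<in>ball 0 1. (1 - cmod \<zeta>) * (disc_weight (cmod \<zeta>) powr j *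
      growth_scale k (disc_weight (cmod \<zeta>))) * cmod (deriv b \<zeta>) \<le> C) \<and>
    (\<exists>C. \<forall>\<zeta>\<in>ball 0 1. cmod (b \<zeta>) * disc_weight (cmod \<zeta>) powr (j - k) \<le> C)"
    (is "?mult \<longleftrightarrow> ?deriv \<and> ?value")
proof
  assume "?deriv \<and> ?value"
  then obtain C1 C2 where "\<And>\<zeta>. cmod \<zeta> < 1 \<Longrightarrow> (1 - cmod \<zeta>) * (disc_weight (cmod \<zeta>) powr j *
      growth_scale k (disc_weight (cmod \<zeta>))) * cmod (deriv b \<zeta>) \<le> C1"
    and "\<And>\<zeta>. cmod \<zeta> < 1 \<Longrightarrow> cmod (b \<zeta>) * disc_weight (cmod \<zeta>) powr (j - k) \<le> C2"
    unfolding mem_ball_0[symmetric] by blast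
  then show ?mult using bloch_disc_multiplier_sufficient[OF b] by blast
next
  assume mult: ?mult
  show "?deriv \<and> ?value"
  proof (cases "1 < k")
    case True
    \<comment> \<open>Testing on the constant 1 puts \<open>b\<close> itself in the space of order
      \<open>j\<close>.\<close>
    have "bloch_disc_bound k 0 (\<lambda>_. 1)" by (rule bloch_disc_boundI[where g'="\<lambda>_. 0"]) auto
    then obtain C where C: "bloch_disc_bound j C b" using mult by fastforce
    then obtain C' where
      "\<And>\<zeta>. cmod \<zeta> < 1 \<Longrightarrow> cmod (b \<zeta>) * disc_weight (cmod \<zeta>) powr (j - k) \<le> C'"
      using bloch_disc_bound_weighted_value[OF assms(1) True] by blast
    moreover have "(1 - cmod \<zeta>) * (disc_weight (cmod \<zeta>) powr j *
        growth_scale k (disc_weight (cmod \<zeta>))) * cmod (deriv b \<zeta>) \<le> C" if "cmod \<zeta> < 1" for \<zeta>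
      using bloch_disc_boundD[OF C that] True by (simp add: growth_scale_def)
    ultimately show ?thesis unfolding Ball_def mem_ball_0 by blast
  next
    case False
    then have k: "k \<le> 1" by simp
    obtain M where M: "\<And>C g \<zeta>. 0 < C \<Longrightarrow> bloch_disc_bound k C g \<Longrightarrow> cmod (g 0) \<le> C \<Longrightarrow> cmod \<zeta> < 1 \<Longrightarrow>
      (1 - cmod \<zeta>) * disc_weight (cmod \<zeta>) powr j * cmod (deriv b \<zeta> * g \<zeta> + b \<zeta> * deriv g \<zeta>) \<le> M * C"
      using bloch_disc_multiplier_uniform_scaled[OF b mult] by blast
    obtain C1 where C1: "0 < C1" and large: "\<And>a. cmod a < 1 \<Longrightarrow>
      \<exists>g. bloch_disc_bound k C1 g \<and> cmod (g 0) \<le> C1 \<and> growth_scale k (disc_weight (cmod a)) \<le> cmod (g a)"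
      using bloch_disc_test_large[OF k] by blast
    obtain C2 where C2: "0 < C2" and vanishing: "\<And>a. cmod a < 1 \<Longrightarrow>
      \<exists>g. bloch_disc_bound k C2 g \<and> cmod (g 0) \<le> C2 \<and> g a = 0 \<and>
        1 \<le> (1 - cmod a) * disc_weight (cmod a) powr k * cmod (deriv g a) * C2"
      using bloch_disc_test_vanishing[OF k] by blast
    \<comment> \<open>The test function vanishes at \<open>a\<close>, which removes the term with b'
      and leaves |b(a)| times a weighted derivative that is bounded below.\<close>
    have val: "cmod (b a) * disc_weight (cmod a) powr (j - k) \<le> M * C2 * C2" if a: "cmod a < 1" for a
    proof -
      define w where "w = disc_weight (cmod a)"
      have w: "1 \<le> w" unfolding w_def using a by (intro disc_weight_ge_1) auto
      obtain g where g: "bloch_disc_bound k C2 g" "cmod (g 0) \<le> C2" "g a = 0"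
        and g': "1 \<le> (1 - cmod a) * w powr k * cmod (deriv g a) * C2"
        using vanishing[OF a] unfolding w_def by blast
      have "cmod (b a) * w powr (j - k) * 1
          \<le> cmod (b a) * w powr (j - k) * ((1 - cmod a) * w powr k * cmod (deriv g a) * C2)"
        using g' by (intro mult_left_mono) auto
      also have "\<dots> = ((1 - cmod a) * w powr j * cmod (b a * deriv g a)) * C2"
        using w by (simp add: powr_diff norm_mult)
      also have "\<dots> \<le> M * C2 * C2"
        using M[OF C2 g(1,2) a] C2 g(3) by (intro mult_right_mono) (auto simp: w_def)
      finally show ?thesis by (simp add: w_def)
    qed
    \<comment> \<open>With the values of \<open>b\<close> under control, the term b g' can be
      subtracted from the derivative of the product; what is left is b' times a \<open>g\<close> of
      maximal growth.\<close>
    have "(1 - cmod a) * (disc_weight (cmod a) powr j * growth_scale k (disc_weight (cmod a))) *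
        cmod (deriv b a) \<le> M * C1 + M * C2 * C2 * C1" if a: "cmod a < 1" for a
    proof -
      define w where "w = disc_weight (cmod a)"
      have w: "1 \<le> w" unfolding w_def using a by (intro disc_weight_ge_1) auto
      define t where "t = (1 - cmod a) * w powr j"
      have t: "0 \<le> t" using a by (simp add: t_def)
      obtain g where g: "bloch_disc_bound k C1 g" "cmod (g 0) \<le> C1" and ga: "growth_scale k w \<le> cmod (g a)"
        using large[OF a] unfolding w_def by blast
      have "t * growth_scale k w * cmod (deriv b a) \<le> t * cmod (g a) * cmod (deriv b a)"
        using ga t by (intro mult_right_mono mult_left_mono) auto
      also have "\<dots> = t * cmod ((deriv b a * g a + b a * deriv g a) - b a * deriv g a)"
        by (simp add: norm_mult)
      also have "\<dots> \<le> t * (cmod (deriv b a * g a + b a * deriv g a) + cmod (b a * deriv g a))"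
        using t by (intro mult_left_mono norm_triangle_ineq4)
      also have "\<dots> = t * cmod (deriv b a * g a + b a * deriv g a) +
          (cmod (b a) * w powr (j - k)) * ((1 - cmod a) * w powr k * cmod (deriv g a))"
        using w by (simp add: distrib_left norm_mult t_def powr_diff)
      also have "\<dots> \<le> M * C1 + M * C2 * C2 * C1"
      proof (rule add_mono)
        show "t * cmod (deriv b a * g a + b a * deriv g a) \<le> M * C1"
          using M[OF C1 g a] by (simp add: t_def w_def)
        have v: "cmod (b a) * w powr (j - k) \<le> M * C2 * C2" using val[OF a] by (simp add: w_def)
        then have "0 \<le> M * C2 * C2" by (rule order_trans[rotated]) simp
        moreover have "(1 - cmod a) * w powr k * cmod (deriv g a) \<le> C1"
          using bloch_disc_boundD[OF g(1) a] by (simp add: w_def)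
        ultimately show "(cmod (b a) * w powr (j - k)) * ((1 - cmod a) * w powr k * cmod (deriv g a))
            \<le> M * C2 * C2 * C1"
          using v a by (intro mult_mono[of "cmod (b a) * w powr (j - k)"]) auto
      qed
      finally show ?thesis by (simp add: t_def w_def mult.assoc)
    qed
    with val show ?thesis unfolding Ball_def mem_ball_0 by blast
  qed
qed

subsection \<open>Transfer to the half-plane\<close>

lemma SUP_ennreal_finite_iff:
  "(SUP z\<in>A. ennreal (h z)) < \<infinity> \<longleftrightarrow> (\<exists>C. \<forall>z\<in>A. h z \<le> C)"
proof
  assume fin: "(SUP z\<in>A. ennreal (h z)) < \<infinity>"
  have "h z \<le> enn2real (SUP z\<in>A. ennreal (h z))" if "z \<in> A" for z
  proof -
    have "ennreal (h z) \<le> (SUP z\<in>A. ennreal (h z))" using that by (rule SUP_upper)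
    also have "\<dots> = ennreal (enn2real (SUP z\<in>A. ennreal (h z)))" using fin by simp
    finally show ?thesis by simp
  qed
  then show "\<exists>C. \<forall>z\<in>A. h z \<le> C" by blast
next
  assume "\<exists>C. \<forall>z\<in>A. h z \<le> C"
  then obtain C where "\<forall>z\<in>A. h z \<le> C" by blast
  then have "(SUP z\<in>A. ennreal (h z)) \<le> ennreal C"
    by (intro SUP_least ennreal_leI) auto
  then show "(SUP z\<in>A. ennreal (h z)) < \<infinity>"
    using ennreal_less_top[of C] by (simp add: le_less_trans)
qed

lemma bloch_space_iff:
  "f \<in> bloch_space s \<longleftrightarrow> f holomorphic_on upper_half_plane \<and>
    (\<exists>C. \<forall>z\<in>upper_half_plane. Im z * omega z powr s * cmod (deriv f z) \<le> C)"
  unfolding bloch_space_def bloch_norm_def SUP_ennreal_finite_iff[symmetric]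
  by (simp add: less_top[symmetric])

lemma H_infinity_iff:
  "f \<in> H_infinity s \<longleftrightarrow> f holomorphic_on upper_half_plane \<and>
    (\<exists>C. \<forall>z\<in>upper_half_plane. cmod (f z) * omega z powr s \<le> C)"
  unfolding H_infinity_def SUP_ennreal_finite_iff by simp

section \<open>The Cayley transform and its inverse\<close>

definition disc_to_uhp :: "complex \<Rightarrow> complex"
  where "disc_to_uhp \<zeta> = \<i> * (1 + \<zeta>) / (1 - \<zeta>)"

definition uhp_to_disc :: "complex \<Rightarrow> complex"
  where "uhp_to_disc z = (z - \<i>) / (z + \<i>)"

lemma Im_disc_to_uhp:
  assumes "\<zeta> \<noteq> 1"
  shows "Im (disc_to_uhp \<zeta>) = (1 - (cmod \<zeta>)\<^sup>2) / (cmod (1 - \<zeta>))\<^sup>2"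
  using assms unfolding disc_to_uhp_def cmod_power2 Im_divide
  by (simp add: power2_eq_square algebra_simps)

lemma disc_to_uhp_in:
  assumes "cmod \<zeta> < 1"
  shows "disc_to_uhp \<zeta> \<in> upper_half_plane"
proof -
  have "\<zeta> \<noteq> 1" using assms by auto
  moreover have "(cmod \<zeta>)\<^sup>2 < 1" using assms by (simp add: power_less_one_iff abs_square_less_1)
  ultimately show ?thesis by (simp add: upper_half_plane_def Im_disc_to_uhp)
qed

lemma one_minus_norm_uhp_to_disc:
  assumes "0 < Im z"
  shows "1 - (cmod (uhp_to_disc z))\<^sup>2 = 4 * Im z / (cmod (z + \<i>))\<^sup>2"
proof -
  have "z + \<i> \<noteq> 0" using assms by (auto simp: complex_eq_iff)
  then have "0 < (cmod (z + \<i>))\<^sup>2" by simp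
  moreover have "(cmod (z + \<i>))\<^sup>2 - (cmod (z - \<i>))\<^sup>2 = 4 * Im z"
    unfolding cmod_power2 by (simp add: power2_eq_square algebra_simps)
  ultimately show ?thesis
    by (simp add: uhp_to_disc_def norm_divide power_divide diff_divide_distrib[symmetric]
        flip: \<open>_ = 4 * Im z\<close>) (simp add: diff_divide_distrib)
qed

lemma uhp_to_disc_in:
  assumes "z \<in> upper_half_plane"
  shows "cmod (uhp_to_disc z) < 1"
proof -
  have z: "0 < Im z" using assms by (simp add: upper_half_plane_def)
  then have "z + \<i> \<noteq> 0" by (auto simp: complex_eq_iff)
  then have "0 < 4 * Im z / (cmod (z + \<i>))\<^sup>2" using z by simp
  then have "(cmod (uhp_to_disc z))\<^sup>2 < 1" using one_minus_norm_uhp_to_disc[OF z] by simp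
  then show ?thesis by (simp add: abs_square_less_1)
qed

lemma uhp_to_disc_inverse:
  assumes "z \<in> upper_half_plane"
  shows "disc_to_uhp (uhp_to_disc z) = z"
proof -
  have "z + \<i> \<noteq> 0" using assms by (auto simp: complex_eq_iff upper_half_plane_def)
  then have "1 + uhp_to_disc z = 2 * z / (z + \<i>)" "1 - uhp_to_disc z = 2 * \<i> / (z + \<i>)"
    by (auto simp: uhp_to_disc_def field_simps)
  then show ?thesis using \<open>z + \<i> \<noteq> 0\<close> by (simp add: disc_to_uhp_def)
qed

lemma disc_to_uhp_inverse:
  assumes "cmod \<zeta> < 1"
  shows "uhp_to_disc (disc_to_uhp \<zeta>) = \<zeta>"
proof -
  have "1 - \<zeta> \<noteq> 0" using assms by auto
  then have "disc_to_uhp \<zeta> - \<i> = 2 * \<i> * \<zeta> / (1 - \<zeta>)" "disc_to_uhp \<zeta> + \<i> = 2 * \<i> / (1 - \<zeta>)"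
    by (auto simp: disc_to_uhp_def field_simps)
  then show ?thesis using \<open>1 - \<zeta> \<noteq> 0\<close> by (simp add: uhp_to_disc_def)
qed

lemma open_upper_half_plane: "open upper_half_plane"
  by (simp add: upper_half_plane_def open_halfspace_Im_gt)

lemma disc_to_uhp_has_field_derivative:
  assumes "cmod \<zeta> < 1"
  shows "(disc_to_uhp has_field_derivative 2 * \<i> / (1 - \<zeta>)\<^sup>2) (at \<zeta>)"
proof -
  have "1 - \<zeta> \<noteq> 0" using assms by auto
  then show ?thesis
    unfolding disc_to_uhp_def[abs_def]
    by (auto intro!: derivative_eq_intros simp: power2_eq_square field_simps)
qed

lemma disc_to_uhp_holomorphic: "disc_to_uhp holomorphic_on ball 0 1"
  using disc_to_uhp_has_field_derivative by (metis holomorphic_on_open mem_ball_0 open_ball)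

lemma uhp_to_disc_holomorphic: "uhp_to_disc holomorphic_on upper_half_plane"
  unfolding uhp_to_disc_def[abs_def]
  by (intro holomorphic_intros) (auto simp: complex_eq_iff upper_half_plane_def)

lemma holomorphic_disc_to_uhp_iff:
  "(\<lambda>\<zeta>. f (disc_to_uhp \<zeta>)) holomorphic_on ball 0 1 \<longleftrightarrow> f holomorphic_on upper_half_plane"
proof
  assume "f holomorphic_on upper_half_plane"
  moreover have "disc_to_uhp ` ball 0 1 \<subseteq> upper_half_plane" by (auto simp: disc_to_uhp_in)
  ultimately show "(\<lambda>\<zeta>. f (disc_to_uhp \<zeta>)) holomorphic_on ball 0 1"
    using holomorphic_on_compose_gen[OF disc_to_uhp_holomorphic] by (simp add: o_def)
next
  assume "(\<lambda>\<zeta>. f (disc_to_uhp \<zeta>)) holomorphic_on ball 0 1"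
  moreover have "uhp_to_disc ` upper_half_plane \<subseteq> ball 0 1" by (auto simp: uhp_to_disc_in)
  ultimately have "(\<lambda>z. f (disc_to_uhp (uhp_to_disc z))) holomorphic_on upper_half_plane"
    using holomorphic_on_compose_gen[OF uhp_to_disc_holomorphic] by (fastforce simp: o_def)
  then show "f holomorphic_on upper_half_plane"
    by (rule holomorphic_transform) (simp add: uhp_to_disc_inverse)
qed

text \<open>The modulus of the derivative of the Cayley transform is 2 / |1 - \<zeta>|^2, and the
  imaginary part of its value is (1 - |\<zeta>|^2) / |1 - \<zeta>|^2: the same denominator
  cancels.\<close>

lemma norm_deriv_disc_to_uhp:
  assumes f: "f holomorphic_on upper_half_plane" and \<zeta>: "cmod \<zeta> < 1"
  shows "(1 - (cmod \<zeta>)\<^sup>2) * cmod (deriv (\<lambda>\<zeta>. f (disc_to_uhp \<zeta>)) \<zeta>)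
    = 2 * (Im (disc_to_uhp \<zeta>) * cmod (deriv f (disc_to_uhp \<zeta>)))"
proof -
  have "\<zeta> \<noteq> 1" using \<zeta> by auto
  have "(f has_field_derivative deriv f (disc_to_uhp \<zeta>)) (at (disc_to_uhp \<zeta>))"
    using f open_upper_half_plane disc_to_uhp_in[OF \<zeta>] by (rule holomorphic_derivI)
  then have "deriv (\<lambda>\<zeta>. f (disc_to_uhp \<zeta>)) \<zeta> = deriv f (disc_to_uhp \<zeta>) * (2 * \<i> / (1 - \<zeta>)\<^sup>2)"
    using disc_to_uhp_has_field_derivative[OF \<zeta>] by (intro DERIV_imp_deriv DERIV_chain2)
  then show ?thesis
    using \<open>\<zeta> \<noteq> 1\<close> by (simp add: Im_disc_to_uhp norm_mult norm_divide norm_power)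
qed

section \<open>Comparison of the weights on the half-plane and the disc\<close>

lemma omega_ge_1: "1 \<le> omega z"
  by (simp add: omega_def ln_plus_def)

text \<open>With \<zeta> the image of z, 1 - |\<zeta>|^2 = 4 Im z / |z + i|^2, so the disc weight
  lies between the explicit \<open>W\<close> and \<open>W + 1\<close>. Both logarithms in
  \<open>omega\<close> can be read off \<open>W\<close>: \<open>W + 1\<close> is at most 3
  \<open>omega z\<close>, and \<open>omega z\<close> is at most \<open>W + 2\<close>, hence at most
  three times the disc weight, which is at least 1.\<close>

lemma omega_disc_weight_comparable:
  assumes z: "z \<in> upper_half_plane"
  shows "disc_weight (cmod (uhp_to_disc z)) \<le> 3 * omega z"
    and "omega z \<le> 3 * disc_weight (cmod (uhp_to_disc z))"
proof -
  define r where "r = cmod (uhp_to_disc z)"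
  define y where "y = Im z"
  have y: "0 < y" using z by (simp add: y_def upper_half_plane_def)
  have r: "0 \<le> r" "r < 1" using uhp_to_disc_in[OF z] by (auto simp: r_def)
  have sq: "(cmod (z + \<i>))\<^sup>2 = (cmod z)\<^sup>2 + 2 * y + 1"
    unfolding cmod_power2 by (simp add: power2_eq_square y_def algebra_simps)
  then have "1\<^sup>2 \<le> (cmod (z + \<i>))\<^sup>2" "(cmod z)\<^sup>2 \<le> (cmod (z + \<i>))\<^sup>2" using y by auto
  then have ge: "1 \<le> cmod (z + \<i>)" "cmod z \<le> cmod (z + \<i>)"
    by (auto intro: power2_le_imp_le)
  define W where "W = 1 + 2 * ln (cmod (z + \<i>)) - ln 4 - ln y"
  have "disc_weight r = W + ln (1 + r)"
  proof -
    have "(1 - r) * (1 + r) = 1 - r\<^sup>2" by (simp add: power2_eq_square algebra_simps)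
    then have "ln ((1 - r) * (1 + r)) = ln (4 * y / (cmod (z + \<i>))\<^sup>2)"
      using one_minus_norm_uhp_to_disc[of z] y by (simp only: r_def y_def)
    moreover have "ln ((1 - r) * (1 + r)) = ln (1 - r) + ln (1 + r)"
      using r by (intro ln_mult_pos) auto
    moreover have "ln (4 * y / (cmod (z + \<i>))\<^sup>2) = ln 4 + ln y - 2 * ln (cmod (z + \<i>))"
      using y ge by (subst ln_divide_pos) (auto simp: ln_mult_pos ln_realpow)
    ultimately show ?thesis by (simp add: disc_weight_def W_def)
  qed
  moreover have "0 \<le> ln (1 + r)" "ln (1 + r) \<le> 1"
    using r ln_add_one_self_le_self[of r] by auto
  ultimately have w: "W \<le> disc_weight r" "disc_weight r \<le> W + 1" by auto
  have ln4: "ln 4 = 2 * ln (2::real)" "ln (2::real) \<le> 1" "0 \<le> ln (2::real)"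
    using ln_realpow[of 2 2] ln_2_less_1 by auto
  have lny: "ln_plus (1 / y) = max (- ln y) 0" using y by (simp add: ln_plus_def ln_div)
  have "ln (cmod (z + \<i>)) \<le> ln 2 + ln_plus (cmod z)"
  proof (cases "1 \<le> cmod z")
    case True
    then have "cmod (z + \<i>) \<le> 2 * cmod z" using norm_triangle_ineq[of z \<i>] by simp
    then have "ln (cmod (z + \<i>)) \<le> ln (2 * cmod z)" using ge by (subst ln_le_cancel_iff) auto
    also have "\<dots> = ln 2 + ln (cmod z)" using True by (subst ln_mult_pos) auto
    finally show ?thesis by (simp add: ln_plus_def)
  next
    case False
    then have "cmod (z + \<i>) \<le> 2" using norm_triangle_ineq[of z \<i>] by simp
    then have "ln (cmod (z + \<i>)) \<le> ln 2" using ge by (subst ln_le_cancel_iff) auto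
    then show ?thesis by (simp add: ln_plus_def)
  qed
  moreover have nonneg: "0 \<le> ln_plus (cmod z)" "0 \<le> ln_plus (1 / y)" by (auto simp: ln_plus_def)
  ultimately have "W + 1 \<le> 3 * omega z"
    using lny ln4 by (simp add: omega_def W_def flip: y_def)
  then show "disc_weight (cmod (uhp_to_disc z)) \<le> 3 * omega z" using w by (simp add: r_def)
  have lz: "ln_plus (cmod z) \<le> ln (cmod (z + \<i>))"
  \<comment> \<open>Monotonicity of \<open>ln\<close> requires a positive argument; at 0 the default
    value \<open>ln 0 = 0\<close> makes \<open>ln_plus\<close> vanish.\<close>
  proof (cases "z = 0")
    case False
    then have "ln (cmod z) \<le> ln (cmod (z + \<i>))" using ge by (subst ln_le_cancel_iff) auto
    then show ?thesis using ge by (simp add: ln_plus_def)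
  qed (simp add: ln_plus_def)
  have "omega z \<le> W + 2"
  proof (cases "y \<le> 1")
    case True
    then have "ln_plus (1 / y) = - ln y" using lny y by simp
    then show ?thesis using lz ln4 nonneg by (simp add: omega_def W_def flip: y_def)
  next
    case False
    \<comment> \<open>For large Im z, one of the two copies of ln |z + i| in \<open>W\<close>
      absorbs - ln y and the other bounds \<open>ln_plus (cmod z)\<close>.\<close>
    then have "ln y \<le> ln (cmod (z + \<i>))"
      using y ge abs_Im_le_cmod[of z] by (subst ln_le_cancel_iff) (auto simp: y_def)
    moreover have "ln_plus (1 / y) = 0" using False lny by simp
    ultimately show ?thesis using lz ln4 by (simp add: omega_def W_def flip: y_def)
  qed
  moreover have "1 \<le> disc_weight r" using r by (rule disc_weight_ge_1)
  ultimately show "omega z \<le> 3 * disc_weight (cmod (uhp_to_disc z))" using w by (simp add: r_def)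
qed

section \<open>Transfer of the boundedness conditions\<close>

lemma bounded_disc_to_uhp_iff:
  fixes F :: "complex \<Rightarrow> real"
  assumes "0 \<le> c"
    and le: "\<And>\<zeta>. cmod \<zeta> < 1 \<Longrightarrow> F (disc_to_uhp \<zeta>) \<le> c * G \<zeta>"
    and ge: "\<And>\<zeta>. cmod \<zeta> < 1 \<Longrightarrow> G \<zeta> \<le> c * F (disc_to_uhp \<zeta>)"
  shows "(\<exists>C. \<forall>z\<in>upper_half_plane. F z \<le> C) \<longleftrightarrow> (\<exists>C. \<forall>\<zeta>\<in>ball 0 1. G \<zeta> \<le> C)"
proof
  assume "\<exists>C. \<forall>z\<in>upper_half_plane. F z \<le> C"
  then obtain C where "\<And>z. z \<in> upper_half_plane \<Longrightarrow> F z \<le> C" by blast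
  then have "G \<zeta> \<le> c * C" if "\<zeta> \<in> ball 0 1" for \<zeta>
    using ge[of \<zeta>] mult_left_mono[of "F (disc_to_uhp \<zeta>)" C c] that assms(1)
    by (force simp: disc_to_uhp_in)
  then show "\<exists>C. \<forall>\<zeta>\<in>ball 0 1. G \<zeta> \<le> C" by blast
next
  assume "\<exists>C. \<forall>\<zeta>\<in>ball 0 1. G \<zeta> \<le> C"
  then obtain C where C: "\<And>\<zeta>. \<zeta> \<in> ball 0 1 \<Longrightarrow> G \<zeta> \<le> C" by blast
  have "F z \<le> c * C" if z: "z \<in> upper_half_plane" for z
    using le[OF uhp_to_disc_in[OF z]] mult_left_mono[OF C[of "uhp_to_disc z"] assms(1)]
    by (simp add: uhp_to_disc_inverse[OF z] uhp_to_disc_in[OF z])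
  then show "\<exists>C. \<forall>z\<in>upper_half_plane. F z \<le> C" by blast
qed

text \<open>In the logarithmic case comparability of the arguments gives only an additive error ln c
  \<le> c - 1, which the summand 1 in \<open>growth_scale\<close> turns into a factor
  \<open>c\<close>.\<close>

lemma growth_scale_comparable:
  assumes "1 \<le> c"
  obtains C where "1 \<le> C" "\<And>x y. 1 \<le> x \<Longrightarrow> 1 \<le> y \<Longrightarrow> x \<le> c * y \<Longrightarrow> y \<le> c * x \<Longrightarrow>
    growth_scale k x \<le> C * growth_scale k y"
proof -
  consider "k < 1" | "k = 1" | "1 < k" by linarith
  then show ?thesis
  proof cases
    case 1
    show ?thesis
    proof (rule that[of "c powr \<bar>1 - k\<bar>"])
      show "1 \<le> c powr \<bar>1 - k\<bar>" using assms by (simp add: ge_one_powr_ge_zero)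
      show "growth_scale k x \<le> c powr \<bar>1 - k\<bar> * growth_scale k y"
        if "1 \<le> x" "1 \<le> y" "x \<le> c * y" "y \<le> c * x" for x y
        using 1 that assms powr_le_comparable[of x y c "1 - k"] by (simp add: growth_scale_def)
    qed
  next
    case 2
    show ?thesis
    proof (rule that[of c])
      show "growth_scale k x \<le> c * growth_scale k y"
        if "1 \<le> x" "1 \<le> y" "x \<le> c * y" "y \<le> c * x" for x y
      proof -
        have "ln x \<le> ln (c * y)" using that by (subst ln_le_cancel_iff) auto
        also have "\<dots> = ln c + ln y" using that assms by (intro ln_mult_pos) auto
        also have "\<dots> \<le> (c - 1) + c * ln y"
          using that assms ln_le_minus_one[of c] mult_right_mono[of 1 c "ln y"] by simp
        finally show ?thesis using 2 by (simp add: growth_scale_def algebra_simps)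
      qed
    qed fact
  next
    case 3
    show ?thesis by (rule that[OF assms]) (use 3 assms in \<open>simp add: growth_scale_def\<close>)
  qed
qed

lemma omega_disc_to_uhp_comparable:
  assumes "cmod \<zeta> < 1"
  shows "disc_weight (cmod \<zeta>) \<le> 3 * omega (disc_to_uhp \<zeta>)"
    and "omega (disc_to_uhp \<zeta>) \<le> 3 * disc_weight (cmod \<zeta>)"
  using omega_disc_weight_comparable[OF disc_to_uhp_in[OF assms]]
  by (simp_all add: disc_to_uhp_inverse[OF assms])

lemma omega_powr_growth_scale_comparable:
  obtains C where "0 \<le> C"
    and "\<And>\<zeta>. cmod \<zeta> < 1 \<Longrightarrow>
      omega (disc_to_uhp \<zeta>) powr j * growth_scale k (omega (disc_to_uhp \<zeta>))
      \<le> C * (disc_weight (cmod \<zeta>) powr j * growth_scale k (disc_weight (cmod \<zeta>)))"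
    and "\<And>\<zeta>. cmod \<zeta> < 1 \<Longrightarrow>
      disc_weight (cmod \<zeta>) powr j * growth_scale k (disc_weight (cmod \<zeta>))
      \<le> C * (omega (disc_to_uhp \<zeta>) powr j * growth_scale k (omega (disc_to_uhp \<zeta>)))"
proof -
  obtain C where C: "1 \<le> C" "\<And>x y. 1 \<le> x \<Longrightarrow> 1 \<le> y \<Longrightarrow> x \<le> 3 * y \<Longrightarrow> y \<le> 3 * x \<Longrightarrow>
    growth_scale k x \<le> C * growth_scale k y"
    using growth_scale_comparable[of 3 k] by auto
  have *: "x powr j * growth_scale k x \<le> (3 powr \<bar>j\<bar> * C) * (y powr j * growth_scale k y)"
    if "1 \<le> x" "1 \<le> y" "x \<le> 3 * y" "y \<le> 3 * x" for x y
  proof -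
    have "x powr j * growth_scale k x \<le> (3 powr \<bar>j\<bar> * y powr j) * (C * growth_scale k y)"
      using that growth_scale_ge_1[of x k]
      by (intro mult_mono C powr_le_comparable) auto
    then show ?thesis by (simp add: mult_ac)
  qed
  show ?thesis
    by (rule that[of "3 powr \<bar>j\<bar> * C"])
      (use C(1) in \<open>auto intro!: * omega_ge_1 disc_weight_ge_1 omega_disc_to_uhp_comparable\<close>)
qed

lemma omega_powr_comparable:
  assumes "cmod \<zeta> < 1"
  shows "omega (disc_to_uhp \<zeta>) powr s \<le> 3 powr \<bar>s\<bar> * disc_weight (cmod \<zeta>) powr s"
    and "disc_weight (cmod \<zeta>) powr s \<le> 3 powr \<bar>s\<bar> * omega (disc_to_uhp \<zeta>) powr s"
proof -
  have "0 < omega (disc_to_uhp \<zeta>)" using omega_ge_1[of "disc_to_uhp \<zeta>"] by simp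
  moreover have "0 < disc_weight (cmod \<zeta>)" using disc_weight_ge_1[of "cmod \<zeta>"] assms by simp
  ultimately show "omega (disc_to_uhp \<zeta>) powr s \<le> 3 powr \<bar>s\<bar> * disc_weight (cmod \<zeta>) powr s"
    and "disc_weight (cmod \<zeta>) powr s \<le> 3 powr \<bar>s\<bar> * omega (disc_to_uhp \<zeta>) powr s"
    using omega_disc_to_uhp_comparable[OF assms] by (auto intro!: powr_le_comparable)
qed

lemma weighted_value_bounded_disc_to_uhp_iff:
  "(\<exists>C. \<forall>z\<in>upper_half_plane. cmod (f z) * omega z powr s \<le> C) \<longleftrightarrow>
    (\<exists>C. \<forall>\<zeta>\<in>ball 0 1. cmod (f (disc_to_uhp \<zeta>)) * disc_weight (cmod \<zeta>) powr s \<le> C)"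
  using mult_left_mono[OF omega_powr_comparable(1)] mult_left_mono[OF omega_powr_comparable(2)]
  by (intro bounded_disc_to_uhp_iff[of "3 powr \<bar>s\<bar>"]) (auto simp: mult.left_commute)

text \<open>General comparable weights \<open>A\<close> and \<open>B\<close>, since it serves both
  for the Bloch spaces (powers of \<open>omega\<close>) and for the derivative condition on
  multipliers (powers times \<open>growth_scale\<close>).\<close>

lemma weighted_deriv_bounded_disc_to_uhp_iff:
  assumes f: "f holomorphic_on upper_half_plane" and "0 \<le> c"
    and A: "\<And>\<zeta>. cmod \<zeta> < 1 \<Longrightarrow> A (disc_to_uhp \<zeta>) \<le> c * B \<zeta>"
    and B: "\<And>\<zeta>. cmod \<zeta> < 1 \<Longrightarrow> B \<zeta> \<le> c * A (disc_to_uhp \<zeta>)"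
    and A0: "\<And>z. 0 \<le> A z" and B0: "\<And>\<zeta>. cmod \<zeta> < 1 \<Longrightarrow> 0 \<le> B \<zeta>"
  shows "(\<exists>C. \<forall>z\<in>upper_half_plane. Im z * A z * cmod (deriv f z) \<le> C) \<longleftrightarrow>
    (\<exists>C. \<forall>\<zeta>\<in>ball 0 1. (1 - cmod \<zeta>) * B \<zeta> * cmod (deriv (\<lambda>\<zeta>. f (disc_to_uhp \<zeta>)) \<zeta>) \<le> C)"
\<comment> \<open>The extra 2 comes from (1 - |\<zeta>|^2) = (1 - |\<zeta>|)(1 + |\<zeta>|), whose
  second factor lies between 1 and 2.\<close>
proof (rule bounded_disc_to_uhp_iff[of "2 * c"])
  fix \<zeta> :: complex assume \<zeta>: "cmod \<zeta> < 1"
  define d where "d = cmod (deriv (\<lambda>\<zeta>. f (disc_to_uhp \<zeta>)) \<zeta>)"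
  define e where "e = Im (disc_to_uhp \<zeta>) * cmod (deriv f (disc_to_uhp \<zeta>))"
  have "(1 - cmod \<zeta>) * d * (1 + cmod \<zeta>) = (1 - (cmod \<zeta>)\<^sup>2) * d"
    by (simp add: power2_eq_square algebra_simps)
  also have "\<dots> = 2 * e"
    unfolding d_def e_def by (rule norm_deriv_disc_to_uhp[OF f \<zeta>])
  finally have eq: "(1 - cmod \<zeta>) * d * (1 + cmod \<zeta>) = 2 * e" .
  have d: "0 \<le> (1 - cmod \<zeta>) * d" using \<zeta> by (simp add: d_def)
  have de: "(1 - cmod \<zeta>) * d \<le> 2 * e" "e \<le> (1 - cmod \<zeta>) * d"
    using mult_left_mono[OF _ d, of 1 "1 + cmod \<zeta>"] mult_left_mono[OF _ d, of "1 + cmod \<zeta>" 2] \<zeta>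
    unfolding eq by auto
  have e: "0 \<le> e" using de d by linarith
  have "A (disc_to_uhp \<zeta>) * e \<le> c * B \<zeta> * (2 * ((1 - cmod \<zeta>) * d))"
    using de d e A[OF \<zeta>] B0[OF \<zeta>] assms(2) by (intro mult_mono) auto
  then show "Im (disc_to_uhp \<zeta>) * A (disc_to_uhp \<zeta>) * cmod (deriv f (disc_to_uhp \<zeta>))
      \<le> 2 * c * ((1 - cmod \<zeta>) * B \<zeta> * cmod (deriv (\<lambda>\<zeta>. f (disc_to_uhp \<zeta>)) \<zeta>))"
    by (simp add: d_def e_def mult_ac)
  have "B \<zeta> * ((1 - cmod \<zeta>) * d) \<le> c * A (disc_to_uhp \<zeta>) * (2 * e)"
    using de d e B[OF \<zeta>] A0 assms(2) by (intro mult_mono[of "B \<zeta>"]) auto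
  then show "(1 - cmod \<zeta>) * B \<zeta> * cmod (deriv (\<lambda>\<zeta>. f (disc_to_uhp \<zeta>)) \<zeta>)
      \<le> 2 * c * (Im (disc_to_uhp \<zeta>) * A (disc_to_uhp \<zeta>) * cmod (deriv f (disc_to_uhp \<zeta>)))"
    by (simp add: d_def e_def mult_ac)
qed (use assms in auto)

lemma bloch_space_iff_disc:
  "f \<in> bloch_space s \<longleftrightarrow> (\<exists>C. bloch_disc_bound s C (\<lambda>\<zeta>. f (disc_to_uhp \<zeta>)))"
proof (cases "f holomorphic_on upper_half_plane")
  case True
  show ?thesis
    unfolding bloch_space_iff bloch_disc_bound_def holomorphic_disc_to_uhp_iff
    using True weighted_deriv_bounded_disc_to_uhp_iff[OF True, of "3 powr \<bar>s\<bar>"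
        "\<lambda>z. omega z powr s" "\<lambda>\<zeta>. disc_weight (cmod \<zeta>) powr s"]
    by (simp add: omega_powr_comparable)
next
  case False
  then show ?thesis by (simp add: bloch_space_iff bloch_disc_bound_def holomorphic_disc_to_uhp_iff)
qed

text \<open>The two Cayley maps are inverse to each other only on the disc and the half-plane, so
  round trips agree with the original function on the disc alone.\<close>

lemma bloch_disc_bound_cong:
  assumes "bloch_disc_bound s C f" and eq: "\<And>\<zeta>. cmod \<zeta> < 1 \<Longrightarrow> f \<zeta> = g \<zeta>"
  shows "bloch_disc_bound s C g"
proof (rule bloch_disc_boundI)
  fix \<zeta> :: complex assume \<zeta>: "cmod \<zeta> < 1"
  show "(g has_field_derivative deriv f \<zeta>) (at \<zeta>)"
    using bloch_disc_bound_deriv[OF assms(1) \<zeta>] open_ball[of 0 1]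
    by (rule has_field_derivative_transform_within_open) (use \<zeta> eq in auto)
  show "(1 - cmod \<zeta>) * disc_weight (cmod \<zeta>) powr s * cmod (deriv f \<zeta>) \<le> C"
    by (rule bloch_disc_boundD[OF assms(1) \<zeta>])
qed

text \<open>Composition with the Cayley transform respects products and carries the Bloch spaces to
  those on the disc, so the disc criterion transfers for all \<open>k\<close> at once.\<close>

lemma pointwise_multipliers_bloch_iff:
  assumes "j \<le> k"
  shows "b \<in> pointwise_multipliers (bloch_space k) (bloch_space j) \<longleftrightarrow> b \<in> H_infinity (j - k) \<and>
    (\<exists>C. \<forall>z\<in>upper_half_plane.
      Im z * (omega z powr j * growth_scale k (omega z)) * cmod (deriv b z) \<le> C)"
proof (cases "b holomorphic_on upper_half_plane")
  case True
  let ?b = "\<lambda>\<zeta>. b (disc_to_uhp \<zeta>)"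
  have "b \<in> pointwise_multipliers (bloch_space k) (bloch_space j) \<longleftrightarrow>
    (\<forall>g C. bloch_disc_bound k C g \<longrightarrow> (\<exists>C'. bloch_disc_bound j C' (\<lambda>\<zeta>. ?b \<zeta> * g \<zeta>)))"
  proof
    assume b: "b \<in> pointwise_multipliers (bloch_space k) (bloch_space j)"
    show "\<forall>g C. bloch_disc_bound k C g \<longrightarrow> (\<exists>C'. bloch_disc_bound j C' (\<lambda>\<zeta>. ?b \<zeta> * g \<zeta>))"
    proof (intro allI impI)
      fix g C assume "bloch_disc_bound k C g"
      then have "bloch_disc_bound k C (\<lambda>\<zeta>. g (uhp_to_disc (disc_to_uhp \<zeta>)))"
        by (rule bloch_disc_bound_cong) (simp add: disc_to_uhp_inverse)
      then have "(\<lambda>z. g (uhp_to_disc z)) \<in> bloch_space k"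
        unfolding bloch_space_iff_disc by blast
      then have "(\<lambda>z. b z * g (uhp_to_disc z)) \<in> bloch_space j"
        using b by (auto simp: pointwise_multipliers_def)
      then obtain C' where "bloch_disc_bound j C' (\<lambda>\<zeta>. ?b \<zeta> * g (uhp_to_disc (disc_to_uhp \<zeta>)))"
        unfolding bloch_space_iff_disc by blast
      then have "bloch_disc_bound j C' (\<lambda>\<zeta>. ?b \<zeta> * g \<zeta>)"
        by (rule bloch_disc_bound_cong) (simp add: disc_to_uhp_inverse)
      then show "\<exists>C'. bloch_disc_bound j C' (\<lambda>\<zeta>. ?b \<zeta> * g \<zeta>)" by blast
    qed
  next
    assume "\<forall>g C. bloch_disc_bound k C g \<longrightarrow> (\<exists>C'. bloch_disc_bound j C' (\<lambda>\<zeta>. ?b \<zeta> * g \<zeta>))"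
    then show "b \<in> pointwise_multipliers (bloch_space k) (bloch_space j)"
      using True unfolding pointwise_multipliers_def Ball_def mem_Collect_eq bloch_space_iff_disc
      by blast
  qed
  also have "\<dots> \<longleftrightarrow> (\<exists>C. \<forall>\<zeta>\<in>ball 0 1. (1 - cmod \<zeta>) * (disc_weight (cmod \<zeta>) powr j *
      growth_scale k (disc_weight (cmod \<zeta>))) * cmod (deriv ?b \<zeta>) \<le> C) \<and>
    (\<exists>C. \<forall>\<zeta>\<in>ball 0 1. cmod (?b \<zeta>) * disc_weight (cmod \<zeta>) powr (j - k) \<le> C)"
    using True by (intro bloch_disc_multiplier_iff[OF assms]) (simp add: holomorphic_disc_to_uhp_iff)
  also have "(\<exists>C. \<forall>\<zeta>\<in>ball 0 1. (1 - cmod \<zeta>) * (disc_weight (cmod \<zeta>) powr j *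
      growth_scale k (disc_weight (cmod \<zeta>))) * cmod (deriv ?b \<zeta>) \<le> C) \<longleftrightarrow>
    (\<exists>C. \<forall>z\<in>upper_half_plane.
      Im z * (omega z powr j * growth_scale k (omega z)) * cmod (deriv b z) \<le> C)"
  proof -
    obtain C where "0 \<le> C" "\<And>\<zeta>. cmod \<zeta> < 1 \<Longrightarrow>
        omega (disc_to_uhp \<zeta>) powr j * growth_scale k (omega (disc_to_uhp \<zeta>))
        \<le> C * (disc_weight (cmod \<zeta>) powr j * growth_scale k (disc_weight (cmod \<zeta>)))"
      "\<And>\<zeta>. cmod \<zeta> < 1 \<Longrightarrow>
        disc_weight (cmod \<zeta>) powr j * growth_scale k (disc_weight (cmod \<zeta>))
        \<le> C * (omega (disc_to_uhp \<zeta>) powr j * growth_scale k (omega (disc_to_uhp \<zeta>)))"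
      using omega_powr_growth_scale_comparable by blast
    moreover have gs: "0 \<le> growth_scale k x" if "1 \<le> x" for x
      using growth_scale_ge_1[OF that, of k] by simp
    ultimately show ?thesis
      by (intro weighted_deriv_bounded_disc_to_uhp_iff[OF True, symmetric])
        (auto intro!: mult_nonneg_nonneg gs omega_ge_1 disc_weight_ge_1)
  qed
  also have "(\<exists>C. \<forall>\<zeta>\<in>ball 0 1. cmod (?b \<zeta>) * disc_weight (cmod \<zeta>) powr (j - k) \<le> C) \<longleftrightarrow>
      (\<exists>C. \<forall>z\<in>upper_half_plane. cmod (b z) * omega z powr (j - k) \<le> C)"
    by (rule weighted_value_bounded_disc_to_uhp_iff[symmetric])
  finally show ?thesis using True by (auto simp: H_infinity_iff)
next
  case False
  then show ?thesis by (simp add: pointwise_multipliers_def H_infinity_iff)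
qed

section \<open>The three ranges of the exponent\<close>

theorem proposition6:
  fixes j k :: real
  assumes "j \<le> k"
  shows "(k > 1 \<longrightarrow>
            pointwise_multipliers (bloch_space k) (bloch_space j) = bloch_space j) \<and>
         (k < 1 \<longrightarrow>
            pointwise_multipliers (bloch_space k) (bloch_space j) =
              bloch_space (j + 1 - k) \<inter> H_infinity (j - k)) \<and>
         (k = 1 \<longrightarrow>
            pointwise_multipliers (bloch_space k) (bloch_space j) =
              {b \<in> H_infinity (j - 1).
                (SUP z\<in>upper_half_plane.
                  ennreal (Im z * omega z powr j * (1 + ln (omega z)) * cmod (deriv b z))) < \<infinity>})"
proof (intro conjI impI set_eqI)
  fix b assume k: "1 < k"
  show "b \<in> pointwise_multipliers (bloch_space k) (bloch_space j) \<longleftrightarrow> b \<in> bloch_space j"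
  proof
    assume "b \<in> pointwise_multipliers (bloch_space k) (bloch_space j)"
    then show "b \<in> bloch_space j"
      using k by (simp add: pointwise_multipliers_bloch_iff[OF assms] growth_scale_def
          bloch_space_iff H_infinity_iff)
  next
    assume b: "b \<in> bloch_space j"
    \<comment> \<open>The condition on the values, absent from this case of the theorem, is
      recovered on the disc and carried back.\<close>
    then obtain C where "bloch_disc_bound j C (\<lambda>\<zeta>. b (disc_to_uhp \<zeta>))"
      unfolding bloch_space_iff_disc by blast
    then have "\<exists>C. \<forall>\<zeta>\<in>ball 0 1. cmod (b (disc_to_uhp \<zeta>)) * disc_weight (cmod \<zeta>) powr (j - k) \<le> C"
      using bloch_disc_bound_weighted_value[OF assms k] unfolding Ball_def mem_ball_0 by metis
    then have "\<exists>C. \<forall>z\<in>upper_half_plane. cmod (b z) * omega z powr (j - k) \<le> C"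
      unfolding weighted_value_bounded_disc_to_uhp_iff .
    then have "b \<in> H_infinity (j - k)" using b by (auto simp: H_infinity_iff bloch_space_iff)
    then show "b \<in> pointwise_multipliers (bloch_space k) (bloch_space j)"
      using b k by (simp add: pointwise_multipliers_bloch_iff[OF assms] growth_scale_def bloch_space_iff)
  qed
next
  fix b assume k: "k < 1"
  \<comment> \<open>For \<open>k < 1\<close> the scale is itself a power, so the derivative
    condition is that of a Bloch space of shifted order.\<close>
  have "omega z powr j * growth_scale k (omega z) = omega z powr (j + 1 - k)" for z
    using k omega_ge_1[of z] by (simp add: growth_scale_def powr_add[symmetric] algebra_simps)
  then show "b \<in> pointwise_multipliers (bloch_space k) (bloch_space j) \<longleftrightarrow>
      b \<in> bloch_space (j + 1 - k) \<inter> H_infinity (j - k)"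
    by (auto simp: pointwise_multipliers_bloch_iff[OF assms] bloch_space_iff H_infinity_iff)
next
  fix b assume k: "k = 1"
  show "b \<in> pointwise_multipliers (bloch_space k) (bloch_space j) \<longleftrightarrow>
      b \<in> {b \<in> H_infinity (j - 1). (SUP z\<in>upper_half_plane.
        ennreal (Im z * omega z powr j * (1 + ln (omega z)) * cmod (deriv b z))) < \<infinity>}"
    unfolding pointwise_multipliers_bloch_iff[OF assms] mem_Collect_eq SUP_ennreal_finite_iff
    by (simp add: k growth_scale_def mult.assoc)
qed

end
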